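(* For every $\nu\in\mathbb C$, $$\int_{-1}^1 x\,[P_\nu(x)]^4\,dx=\frac{2\sin^4(\nu\pi)\left[\psi^{(2)}(\nu+1)+\psi^{(2)}(-\nu)+28\zeta(3)\right]}{(2\nu+1)^2\pi^4},$$ where for $\nu\in\{-1/2\}\cup\mathbb Z$ the right-hand side is interpreted as the limit of a continuous function of $\nu$, i.e. as the value at that point of the continuous extension to $\mathbb C$ of the expression, which is well-defined for $\nu\in\mathbb C\smallsetminus(\mathbb Z\cup\{-1/2\})$.
   Context: For $\nu\in\mathbb C$, the Legendre function of the first kind $P_\nu$ is defined on $(-1,1)$ by the Mehler--Dirichlet integral $$P_\nu(\cos\theta)=\frac{2}{\pi}\int_0^\theta\frac{\cos\frac{(2\nu+1)\beta}{2}}{\sqrt{2(\cos\beta-\cos\theta)}}\,d\beta,\qquad \theta\in(0,\pi).$$ The polygamma functions are $\psi^{(m)}(z)=\frac{d^{m+1}}{dz^{m+1}}\log\Gamma(z)$ for $m\in\mathbb Z_{\ge 0}$, where $\Gamma$ is the Euler gamma function, and $\zeta(3)=\sum_{n=1}^\infty n^{-3}$. *)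

theory Defs
  imports "HOL-Analysis.Analysis"
begin

text \<open>
  Legendre function of the first kind on the cut \<open>(-1, 1)\<close>, by the Mehler--Dirichlet integral with
  \<open>x = cos \<theta>\<close>, \<open>0 < \<theta> < \<pi>\<close>. Values at \<open>\<bar>x\<bar> \<ge> 1\<close> carry no meaning. The radicand is positive on the
  range of integration, and the endpoint singularity at \<open>\<beta> = \<theta>\<close> is absolutely integrable, so the
  Lebesgue integral is the intended one.
\<close>

definition legendre_P :: "complex \<Rightarrow> real \<Rightarrow> complex" where
  "legendre_P \<nu> x =
     (let \<theta> = arccos x in
        2 / of_real pi *
        (LINT \<beta>:{0<..<\<theta>}|lborel.
           cos ((2 * \<nu> + 1) * of_real \<beta> / 2) / of_real (sqrt (2 * (cos \<beta> - cos \<theta>)))))"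

definition zeta3 :: real where
  "zeta3 = (\<Sum>n. 1 / real (Suc n) ^ 3)"

definition exceptional :: "complex set" where
  "exceptional = \<int> \<union> {- 1 / 2}"

text \<open>
  Meaningful only off \<^const>\<open>exceptional\<close>: elsewhere the totalised division and
  \<^const>\<open>Polygamma\<close> return conventional values at their poles.
\<close>

definition closed_form :: "complex \<Rightarrow> complex" where
  "closed_form \<nu> =
     2 * sin (\<nu> * of_real pi) ^ 4 *
       (Polygamma 2 (\<nu> + 1) + Polygamma 2 (- \<nu>) + 28 * of_real zeta3) /
     ((2 * \<nu> + 1) ^ 2 * of_real pi ^ 4)"

end

theory Submission
  imports Defs "HOL-Complex_Analysis.Complex_Analysis" "HOL-Real_Asymp.Real_Asymp"
begin

text \<open>
  Write \<open>I \<nu>\<close> for the integral of \<open>x (P\<^sub>\<nu> x)\<^sup>4\<close>. Solving the claimed formula for the bracket turns it into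
  the vanishing, off the integers, of the function \<open>defect\<close>, which is
  \<open>\<pi>\<^sup>4 (2 \<nu> + 1)\<^sup>2 I \<nu> / (2 sin\<^sup>4 (\<pi> \<nu>))\<close> minus the bracket. It vanishes because it is constant, by
  Liouville's theorem, and the constant can be read off at \<open>\<nu> = - 1/2\<close>, where the factor \<open>2 \<nu> + 1\<close>
  kills the first term and \<open>\<psi>'' (1/2) = - 14 \<zeta>(3)\<close> kills the bracket. Constancy has three sources.

  Periodicity. The functions \<open>u = P\<^sub>\<nu>\<close> and \<open>v = P\<^sub>\<nu>\<^sub>+\<^sub>1\<close> solve a first-order linear system in \<open>x\<close>, and some form
  of degree four in \<open>u\<close>, \<open>v\<close>, with coefficients polynomial in \<open>x\<close>, has derivative proportional to
  \<open>(2 \<nu> + 3)\<^sup>2 x v\<^sup>4 - (2 \<nu> + 1)\<^sup>2 x u\<^sup>4\<close> (\<open>quartic_certificate\<close>). Its boundary values involve only the limit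
  of \<open>u + v\<close> at \<open>- 1\<close>, in which the logarithmic singularities cancel. The resulting
  difference equation for \<open>I\<close> (\<open>legendre_moment_4_recurrence\<close>) is the one that
  \<open>\<psi>'' (z + 1) = \<psi>'' z + 2 / z\<^sup>3\<close> gives for the bracket, so \<open>defect\<close> has period 1. Since
  \<open>P\<^sub>-\<^sub>1\<^sub>-\<^sub>\<nu> = P\<^sub>\<nu>\<close>, it is also even.

  No poles. It suffices to look at \<open>\<nu> = 0\<close>. There \<open>P\<^sub>\<nu> = 1 + O(\<nu>)\<close>, so that \<open>P\<^sup>4 = 6 P\<^sup>2 - 8 P + 3 + O(\<nu>\<^sup>3)\<close>, and
  the integrals of \<open>x P\<close> and \<open>x P\<^sup>2\<close> are elementary (\<open>legendre_moment_1\<close>, \<open>legendre_moment_2\<close>). Together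
  with evenness this expansion leaves only a removable singularity (\<open>defect_has_limit_at_0\<close>).

  Growth. The Mehler--Dirichlet formula bounds \<open>P\<^sub>\<nu> x\<close> by \<open>exp (\<pi> \<bar>Im \<nu>\<bar>)\<close> times a function of
  \<open>x\<close> with integrable fourth power, hence \<open>I \<nu>\<close> by a constant times \<open>exp (4 \<pi> \<bar>Im \<nu>\<bar>)\<close>, which is the size of \<open>sin\<^sup>4 (\<pi> \<nu>)\<close>. So
  \<open>defect\<close>, extended over its removable singularities, grows at most quadratically.

  The continuous extension in the statement is \<open>I\<close> itself, which is an entire function of \<open>\<nu>\<close>.
\<close>

section \<open>The Mehler--Dirichlet integral in a regular form\<close>

text \<open>
  The substitution \<open>sin (\<beta> / 2) = S sin \<phi>\<close>, with \<open>S = sin (\<theta> / 2) = sqrt ((1 - x) / 2)\<close>, turns the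
  Mehler--Dirichlet integral into one over the fixed interval \<open>[0, \<pi>/2]\<close> whose integrand is smooth
  for \<open>S < 1\<close>. Here \<open>arcsin (S sin \<phi>)\<close> is half the old angle and the denominator is its cosine. The
  parameter is \<open>\<mu> = 2 \<nu> + 1\<close>.
\<close>

definition mehler_kernel :: "complex \<Rightarrow> real \<Rightarrow> real \<Rightarrow> complex" where
  "mehler_kernel \<mu> S \<phi> =
     cos (\<mu> * of_real (arcsin (S * sin \<phi>))) / of_real (sqrt (1 - (S * sin \<phi>)\<^sup>2))"

definition mehler_integral :: "complex \<Rightarrow> real \<Rightarrow> complex" where
  "mehler_integral \<mu> S = integral {0..pi/2} (mehler_kernel \<mu> S)"

lemma abs_mult_sin_le: "0 \<le> S \<Longrightarrow> \<bar>S * sin \<phi>\<bar> \<le> S" for S \<phi> :: real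
  by (simp add: abs_mult mult_left_le)

lemma mult_sin_sq_less_1:
  assumes "0 \<le> S" "S < (1::real)" shows "(S * sin \<phi>)\<^sup>2 < 1"
  using abs_mult_sin_le[OF assms(1), of \<phi>] assms by (simp add: abs_square_less_1)

lemma continuous_on_mehler_kernel:
  "continuous_on ({0..<1} \<times> UNIV) (\<lambda>(S, \<phi>). mehler_kernel \<mu> S \<phi>)"
proof -
  have *: "- 1 \<le> S * sin \<phi>" "S * sin \<phi> \<le> 1" "(S * sin \<phi>)\<^sup>2 \<noteq> 1" if "0 \<le> S" "S < 1" for S \<phi> :: real
    using abs_mult_sin_le[of S \<phi>] mult_sin_sq_less_1[of S \<phi>] that by (auto simp: abs_le_iff)
  show ?thesis
    unfolding mehler_kernel_def split_beta
    by (intro continuous_intros) (use * in force)+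
qed

lemma continuous_on_mehler_kernel_section:
  assumes "0 \<le> S" "S < 1"
  shows "continuous_on A (mehler_kernel \<mu> S)"
  using continuous_on_compose2[OF continuous_on_mehler_kernel, of A "\<lambda>\<phi>. (S, \<phi>)" \<mu>] assms
  by (force intro!: continuous_intros)

lemma einterval_real: "einterval (ereal a) (ereal b) = {a<..<b}"
  by (auto simp: einterval_def)

text \<open>
  The change of variables described above. The old integrand is singular at \<open>\<beta> = \<theta>\<close>, so its
  integrability has to be known before substituting; it follows from the same substitution applied
  to the nonnegative majorant \<open>1 / sqrt (2 (cos \<beta> - cos \<theta>))\<close>.
\<close>

lemma legendre_P_eq_mehler_integral:
  assumes x: "-1 < x" "x < 1"
  shows "legendre_P \<nu> x = 2 / of_real pi * mehler_integral (2 * \<nu> + 1) (sqrt ((1 - x) / 2))"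
proof -
  define S where "S = sqrt ((1 - x) / 2)"
  define \<theta> where "\<theta> = 2 * arcsin S"
  define g where "g = (\<lambda>\<phi>. 2 * arcsin (S * sin \<phi>))"
  define g' where "g' = (\<lambda>\<phi>. 2 * S * cos \<phi> / sqrt (1 - (S * sin \<phi>)\<^sup>2))"
  define h where "h = (\<lambda>\<beta>. 1 / sqrt (2 * (cos \<beta> - cos \<theta>)))"
  define F where "F = (\<lambda>\<beta>. cos ((2 * \<nu> + 1) * of_real \<beta> / 2) / complex_of_real (sqrt (2 * (cos \<beta> - cos \<theta>))))"
  have S: "0 < S" "S < 1" using x by (auto simp: S_def)
  have cos2: "cos (2 * arcsin t) = 1 - 2 * t\<^sup>2" if "\<bar>t\<bar> \<le> 1" for t
    using that by (simp add: cos_double_sin abs_le_iff)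
  have th: "\<theta> = arccos x"
  proof -
    have "cos \<theta> = x" unfolding \<theta>_def using S x by (subst cos2) (auto simp: S_def field_simps)
    moreover have "0 \<le> \<theta>" "\<theta> \<le> pi"
      using arcsin_bounded[of S] arcsin_le_arcsin[of 0 S] S by (auto simp: \<theta>_def)
    ultimately show ?thesis using arccos_cos by metis
  qed
  have ss: "\<bar>S * sin \<phi>\<bar> < 1" for \<phi>
    using abs_mult_sin_le[of S \<phi>] S by linarith
  have cg: "cos (g \<phi>) - cos \<theta> = 2 * S\<^sup>2 * (cos \<phi>)\<^sup>2" for \<phi>
  proof -
    have "cos (g \<phi>) = 1 - 2 * (S * sin \<phi>)\<^sup>2" "cos \<theta> = 1 - 2 * S\<^sup>2"
      unfolding g_def \<theta>_def using ss[of \<phi>] S by (auto intro!: cos2)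
    then show ?thesis by (simp add: power_mult_distrib cos_squared_eq algebra_simps)
  qed
  have pos: "0 < cos \<phi>" if "0 < \<phi>" "\<phi> < pi/2" for \<phi>
    using that by (simp add: cos_gt_zero)
  have cpos: "0 < cos (g \<phi>) - cos \<theta>" if "0 < \<phi>" "\<phi> < pi/2" for \<phi>
    using pos[OF that] S by (simp add: cg)
  have hg: "h (g \<phi>) = 1 / (2 * S * cos \<phi>)" if "0 < \<phi>" "\<phi> < pi/2" for \<phi>
  proof -
    have "sqrt (2 * (cos (g \<phi>) - cos \<theta>)) = sqrt ((2 * S * cos \<phi>)\<^sup>2)"
      by (simp add: cg power_mult_distrib)
    then show ?thesis using pos[OF that] S by (simp add: h_def)
  qed
  have root: "sqrt (1 - (S * sin \<phi>)\<^sup>2) > 0" for \<phi>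
    using mult_sin_sq_less_1[of S \<phi>] S by simp
  have dg: "DERIV g \<phi> :> g' \<phi>" for \<phi>
    unfolding g_def g'_def using ss[of \<phi>] root[of \<phi>]
    by (auto intro!: derivative_eq_intros simp: abs_less_iff field_simps)
  have cg': "isCont g' \<phi>" for \<phi>
    unfolding g'_def using root[of \<phi>] by (auto intro!: continuous_intros)
  have g'nn: "0 \<le> g' \<phi>" if "0 \<le> \<phi>" "\<phi> \<le> pi/2" for \<phi>
    unfolding g'_def using root[of \<phi>] S that by (auto intro!: divide_nonneg_pos mult_nonneg_nonneg cos_ge_zero)
  have lim0: "((ereal \<circ> g \<circ> real_of_ereal) \<longlongrightarrow> ereal 0) (at_right (ereal 0))"
    unfolding ereal_tendsto_simps
    using DERIV_isCont[OF dg, of 0] by (auto simp: isCont_def g_def intro: tendsto_within_subset)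
  have lim1: "((ereal \<circ> g \<circ> real_of_ereal) \<longlongrightarrow> ereal \<theta>) (at_left (ereal (pi/2)))"
    unfolding ereal_tendsto_simps
    using DERIV_isCont[OF dg, of "pi/2"] by (auto simp: isCont_def g_def \<theta>_def intro: tendsto_within_subset)
  have pi2: "ereal 0 < ereal (pi/2)" by simp
  have hsub: "set_integrable lborel (einterval (ereal 0) (ereal \<theta>)) h"
  proof (rule interval_integral_substitution_nonneg(1)[OF pi2 _ _ _ _ _ lim0 lim1])
    show "DERIV g \<phi> :> g' \<phi>" for \<phi> by (rule dg)
    show "isCont g' \<phi>" for \<phi> by (rule cg')
    show "0 \<le> g' \<phi>" if "ereal 0 \<le> ereal \<phi>" "ereal \<phi> \<le> ereal (pi/2)" for \<phi> using g'nn that by simp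
    show "isCont h (g \<phi>)" if "ereal 0 < ereal \<phi>" "ereal \<phi> < ereal (pi/2)" for \<phi>
      unfolding h_def using cpos[of \<phi>] that by (auto intro!: continuous_intros)
    show "0 \<le> h (g \<phi>)" if "ereal 0 < ereal \<phi>" "ereal \<phi> < ereal (pi/2)" for \<phi>
      using hg[of \<phi>] pos[of \<phi>] that S by simp
    have "set_integrable lborel {0..pi/2} (\<lambda>\<phi>. 1 / sqrt (1 - (S * sin \<phi>)\<^sup>2))"
      by (rule borel_integrable_atLeastAtMost') (use root in \<open>auto intro!: continuous_intros simp: less_le\<close>)
    then have "set_integrable lborel {0<..<pi/2} (\<lambda>\<phi>. 1 / sqrt (1 - (S * sin \<phi>)\<^sup>2))"
      by (rule set_integrable_subset) auto
    then show "set_integrable lborel (einterval (ereal 0) (ereal (pi/2))) (\<lambda>\<phi>. h (g \<phi>) * g' \<phi>)"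
      unfolding einterval_real
      by (rule set_integrable_cong[THEN iffD1, rotated -1])
         (use hg pos S in \<open>auto simp: g'_def less_le\<close>)
  qed
  have Fsub: "set_integrable lborel (einterval (ereal 0) (ereal \<theta>)) F"
  proof (rule set_integrable_bound)
    show "set_integrable lborel (einterval (ereal 0) (ereal \<theta>)) (\<lambda>\<beta>. exp (norm (2*\<nu>+1) * \<theta>) * h \<beta>)"
      using hsub by (intro set_integrable_mult_right) auto
    have "(\<lambda>\<beta>. F \<beta>) \<in> borel_measurable lborel"
      unfolding F_def by (intro borel_measurable_divide) (auto intro!: borel_measurable_continuous_onI continuous_intros)
    then show "set_borel_measurable lborel (einterval (ereal 0) (ereal \<theta>)) F"
      unfolding set_borel_measurable_def by (intro borel_measurable_scaleR) auto
    show "AE \<beta> in lborel. \<beta> \<in> einterval (ereal 0) (ereal \<theta>) \<longrightarrow> norm (F \<beta>) \<le> norm (exp (norm (2*\<nu>+1) * \<theta>) * h \<beta>)"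
    proof (intro AE_I2 impI)
      fix \<beta> assume "\<beta> \<in> einterval (ereal 0) (ereal \<theta>)"
      then have b: "0 < \<beta>" "\<beta> < \<theta>" by (auto simp: einterval_real)
      have "norm (cos ((2 * \<nu> + 1) * of_real \<beta> / 2)) \<le> exp (norm (2*\<nu>+1) * \<theta>)"
      proof -
        have "norm (cos ((2 * \<nu> + 1) * of_real \<beta> / 2)) \<le> exp (norm ((2 * \<nu> + 1) * of_real \<beta> / 2))"
          by (rule norm_cos_le)
        also have "norm ((2 * \<nu> + 1) * of_real \<beta> / 2) = norm (2*\<nu>+1) * (\<beta>/2)"
          using b by (simp add: norm_mult norm_divide)
        also have "exp \<dots> \<le> exp (norm (2*\<nu>+1) * \<theta>)" using b mult_left_mono[of "\<beta>/2" \<theta> "norm (2*\<nu>+1)"] by simp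
        finally show ?thesis .
      qed
      then show "norm (F \<beta>) \<le> norm (exp (norm (2*\<nu>+1) * \<theta>) * h \<beta>)"
        unfolding F_def h_def by (simp add: norm_divide abs_mult divide_right_mono)
    qed
  qed
  have fg: "g' \<phi> *\<^sub>R F (g \<phi>) = mehler_kernel (2*\<nu>+1) S \<phi>" if "0 < \<phi>" "\<phi> < pi/2" for \<phi>
  proof -
    have "F (g \<phi>) = cos ((2 * \<nu> + 1) * of_real (arcsin (S * sin \<phi>))) * of_real (h (g \<phi>))"
      by (simp add: F_def h_def g_def)
    then show ?thesis
      using hg[OF that] pos[OF that] S
      by (simp add: mehler_kernel_def g'_def scaleR_conv_of_real field_simps)
  qed
  have ki: "set_integrable lborel {0..pi/2} (mehler_kernel (2*\<nu>+1) S)"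
    by (rule borel_integrable_atLeastAtMost') (use S in \<open>auto intro!: continuous_on_mehler_kernel_section\<close>)
  have ki': "set_integrable lborel {0<..<pi/2} (mehler_kernel (2*\<nu>+1) S)"
    using ki by (rule set_integrable_subset) auto
  have sub: "(LBINT \<beta>=ereal 0..ereal \<theta>. F \<beta>) = (LBINT \<phi>=ereal 0..ereal (pi/2). g' \<phi> *\<^sub>R F (g \<phi>))"
  proof (rule interval_integral_substitution_integrable[OF pi2 _ _ _ _ lim0 lim1])
    show "DERIV g \<phi> :> g' \<phi>" for \<phi> by (rule dg)
    show "isCont g' \<phi>" for \<phi> by (rule cg')
    show "0 \<le> g' \<phi>" if "ereal 0 \<le> ereal \<phi>" "ereal \<phi> \<le> ereal (pi/2)" for \<phi> using g'nn that by simp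
    show "isCont F (g \<phi>)" if "ereal 0 < ereal \<phi>" "ereal \<phi> < ereal (pi/2)" for \<phi>
      unfolding F_def using cpos[of \<phi>] that by (auto intro!: continuous_intros)
    show "set_integrable lborel (einterval (ereal 0) (ereal (pi/2))) (\<lambda>\<phi>. g' \<phi> *\<^sub>R F (g \<phi>))"
      unfolding einterval_real
      by (rule set_integrable_cong[THEN iffD1, rotated -1, OF ki']) (use fg in auto)
  qed (rule Fsub)
  have "(LINT \<beta>:{0<..<\<theta>}|lborel. F \<beta>) = (LBINT \<beta>=ereal 0..ereal \<theta>. F \<beta>)"
    using S arcsin_le_arcsin[of 0 S] by (simp add: interval_lebesgue_integral_def einterval_real \<theta>_def)
  also have "\<dots> = (LINT \<phi>:{0<..<pi/2}|lborel. g' \<phi> *\<^sub>R F (g \<phi>))"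
    unfolding sub by (simp add: interval_lebesgue_integral_def einterval_real)
  also have "\<dots> = (LINT \<phi>:{0<..<pi/2}|lborel. mehler_kernel (2*\<nu>+1) S \<phi>)"
    by (rule set_lebesgue_integral_cong) (use fg in auto)
  also have "\<dots> = integral {0<..<pi/2} (mehler_kernel (2*\<nu>+1) S)"
    using ki' by (rule set_borel_integral_eq_integral)
  also have "\<dots> = mehler_integral (2*\<nu>+1) S"
    unfolding mehler_integral_def
    by (rule integral_open_interval_real[symmetric])
  finally have "(LINT \<beta>:{0<..<\<theta>}|lborel. F \<beta>) = mehler_integral (2*\<nu>+1) S" .
  then show ?thesis
    unfolding legendre_P_def Let_def th[symmetric] S_def[symmetric] F_def by simp
qed

section \<open>Bounds and boundary limits\<close>

lemma norm_cos_le_exp_Im: "norm (cos z) \<le> exp \<bar>Im z\<bar>" for z :: complex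
proof -
  have "norm (cos z) \<le> (norm (exp (\<i> * z)) + norm (exp (- (\<i> * z)))) / 2"
    unfolding cos_exp_eq norm_divide by (simp add: divide_right_mono norm_triangle_ineq del: norm_exp_eq_Re)
  also have "\<dots> \<le> exp \<bar>Im z\<bar>"
  proof -
    have "(norm (exp (\<i> * z)) + norm (exp (- (\<i> * z)))) / 2 = (exp (- Im z) + exp (Im z)) / 2"
      by (simp add: norm_exp_eq_Re)
    also have "\<dots> \<le> (exp \<bar>Im z\<bar> + exp \<bar>Im z\<bar>) / 2"
      by (intro divide_right_mono add_mono) auto
    finally show ?thesis by simp
  qed
  finally show ?thesis .
qed

text \<open>
  Concavity of the cosine on \<open>[0, \<pi>/2]\<close>.
\<close>

lemma cos_ge_chord:
  fixes \<phi> :: real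
  assumes "0 \<le> \<phi>" "\<phi> \<le> pi/2"
  shows "1 - 2 * \<phi> / pi \<le> cos \<phi>"
proof -
  have "convex_on {0..pi/2} (\<lambda>x. - cos x :: real)"
  proof (rule f''_ge0_imp_convex)
    show "DERIV (\<lambda>x. - cos x) x :> sin x" for x :: real by (auto intro!: derivative_eq_intros)
    show "DERIV sin x :> cos x" for x :: real by (auto intro!: derivative_eq_intros)
  qed (auto intro: cos_ge_zero)
  from convex_onD_Icc'[OF this, of \<phi>] assms show ?thesis
    by (simp add: field_simps)
qed

text \<open>
  The radicand is at least \<open>1 - S\<^sup>2\<close> and at least \<open>cos\<^sup>2 \<phi>\<close>; weighting the two bounds \<open>1/4 : 3/4\<close> leaves
  an integrable singularity in \<open>\<phi>\<close> and costs only \<open>(1 - S\<^sup>2) powr (- 1/8)\<close>, whose fourth power is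
  still integrable in \<open>x\<close>. The true growth is only logarithmic.
\<close>

lemma inverse_sqrt_mult_sin_le:
  assumes S: "0 \<le> S" "S < 1" and \<phi>: "0 < \<phi>" "\<phi> < pi/2"
  shows "1 / sqrt (1 - (S * sin \<phi>)\<^sup>2)
           \<le> (1 - S\<^sup>2) powr (-1/8) * (1 - 2 * \<phi> / pi) powr (-3/4)"
proof -
  define r where "r = 1 - (S * sin \<phi>)\<^sup>2"
  define q where "q = 1 - 2 * \<phi> / pi"
  have q: "0 < q" using \<phi> by (simp add: q_def field_simps)
  have e: "0 < 1 - S\<^sup>2" using S by (simp add: abs_square_less_1)
  have s1: "(sin \<phi>)\<^sup>2 \<le> 1" by (simp add: abs_square_le_1)
  have r1: "1 - S\<^sup>2 \<le> r"
    using mult_left_le[OF s1, of "S\<^sup>2"] by (simp add: r_def power_mult_distrib)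
  have "q \<le> cos \<phi>" unfolding q_def using \<phi> by (intro cos_ge_chord) auto
  then have "q\<^sup>2 \<le> (cos \<phi>)\<^sup>2" using q by (intro power_mono) auto
  also have "\<dots> \<le> r"
    using mult_right_mono[of "S\<^sup>2" 1 "(sin \<phi>)\<^sup>2"] e by (simp add: r_def cos_squared_eq power_mult_distrib)
  finally have r2: "q\<^sup>2 \<le> r" .
  have r: "0 < r" using r1 e by linarith
  have "(1 - S\<^sup>2) powr (1/8) * q powr (3/4) = (1 - S\<^sup>2) powr (1/8) * (q\<^sup>2) powr (3/8)"
  proof -
    have "q\<^sup>2 = q powr 2" using q by simp
    then have "(q\<^sup>2) powr (3/8) = q powr (2 * (3/8))" by (simp only: powr_powr)
    then show ?thesis by simp
  qed
  also have "\<dots> \<le> r powr (1/8) * r powr (3/8)"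
    using e r1 r2 by (intro mult_mono powr_mono2) auto
  also have "\<dots> = r powr (1/8 + 3/8)" by (simp only: powr_add)
  also have "\<dots> = sqrt r" using r by (simp add: powr_half_sqrt)
  finally have "1 / sqrt r \<le> 1 / ((1 - S\<^sup>2) powr (1/8) * q powr (3/4))"
    using e q r by (intro divide_left_mono) auto
  also have "\<dots> = (1 - S\<^sup>2) powr (-1/8) * q powr (-3/4)"
    using powr_minus_divide[of "1 - S\<^sup>2" "1/8"] powr_minus_divide[of q "3/4"] by simp
  finally show ?thesis by (simp add: r_def q_def)
qed

lemma has_integral_chord_powr:
  "((\<lambda>\<phi>. (1 - 2 * \<phi> / pi) powr (-3/4)) has_integral 2 * pi) {0<..<pi/2}"
proof -
  have "((\<lambda>\<phi>. (1 - 2 * \<phi> / pi) powr (-3/4)) has_integral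
           (- 2 * pi * (1 - 2 * (pi/2) / pi) powr (1/4)) - (- 2 * pi * (1 - 2 * 0 / pi) powr (1/4))) {0..pi/2}"
  proof (rule fundamental_theorem_of_calculus_interior)
    show "continuous_on {0..pi/2} (\<lambda>\<phi>. - 2 * pi * (1 - 2 * \<phi> / pi) powr (1/4))"
      by (intro continuous_intros continuous_on_powr') (auto simp: field_simps)
    fix \<phi> :: real assume "\<phi> \<in> {0<..<pi/2}"
    then have q: "0 < 1 - 2 * \<phi> / pi" by (simp add: field_simps)
    show "((\<lambda>\<phi>. - 2 * pi * (1 - 2 * \<phi> / pi) powr (1/4)) has_vector_derivative
            (1 - 2 * \<phi> / pi) powr (-3/4)) (at \<phi>)"
      unfolding has_real_derivative_iff_has_vector_derivative[symmetric]
      using q by (auto intro!: derivative_eq_intros simp: field_simps)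
  qed simp
  then show ?thesis by (simp add: has_integral_Icc_iff_Ioo)
qed

lemma norm_integral_angle_le:
  fixes f :: "real \<Rightarrow> complex"
  assumes S: "0 \<le> S" "S < 1" and cont: "continuous_on {0..pi/2} f" and B: "0 \<le> B"
    and f: "\<And>\<phi>. 0 < \<phi> \<Longrightarrow> \<phi> < pi/2 \<Longrightarrow> norm (f \<phi>) \<le> B / sqrt (1 - (S * sin \<phi>)\<^sup>2)"
  shows "norm (integral {0..pi/2} f) \<le> 2 * pi * B * (1 - S\<^sup>2) powr (-1/8)"
proof -
  have fi: "f integrable_on {0<..<pi/2}"
    using integrable_continuous_real[OF cont] by (simp add: integrable_on_Icc_iff_Ioo)
  define g where "g = (\<lambda>\<phi>. B * (1 - S\<^sup>2) powr (-1/8) * (1 - 2 * \<phi> / pi) powr (-3/4))"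
  have gi: "(g has_integral B * (1 - S\<^sup>2) powr (-1/8) * (2 * pi)) {0<..<pi/2}"
    unfolding g_def by (intro has_integral_mult_right has_integral_chord_powr)
  have "norm (f \<phi>) \<le> g \<phi>" if "\<phi> \<in> {0<..<pi/2}" for \<phi>
  proof -
    have "norm (f \<phi>) \<le> B * (1 / sqrt (1 - (S * sin \<phi>)\<^sup>2))" using f[of \<phi>] that by simp
    also have "\<dots> \<le> g \<phi>"
      unfolding g_def mult.assoc
      using inverse_sqrt_mult_sin_le[OF S, of \<phi>] that B by (intro mult_left_mono) auto
    finally show ?thesis .
  qed
  then have "norm (integral {0<..<pi/2} f) \<le> integral {0<..<pi/2} g"
    using fi gi by (intro integral_norm_bound_integral) auto
  also have "integral {0<..<pi/2} g = 2 * pi * B * (1 - S\<^sup>2) powr (-1/8)"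
    using gi by (simp add: integral_unique)
  finally show ?thesis by (simp add: integral_open_interval_real)
qed

lemma arcsin_mult_sin_bounds:
  assumes "0 \<le> S" "S \<le> 1" "0 \<le> \<phi>" "\<phi> \<le> pi/2"
  shows "0 \<le> arcsin (S * sin \<phi>)" "arcsin (S * sin \<phi>) \<le> pi/2"
proof -
  have "0 \<le> S * sin \<phi>" "S * sin \<phi> \<le> 1"
    using assms by (auto intro!: mult_nonneg_nonneg sin_ge_zero mult_le_one)
  then show "0 \<le> arcsin (S * sin \<phi>)" "arcsin (S * sin \<phi>) \<le> pi/2"
    using arcsin_le_arcsin[of 0 "S * sin \<phi>"] arcsin_bounded[of "S * sin \<phi>"] by auto
qed

lemma norm_legendre_P_le:
  assumes "-1 < x" "x < 1"
  shows "norm (legendre_P \<nu> x) \<le> 4 * exp (pi * \<bar>Im \<nu>\<bar>) * ((1 + x) / 2) powr (-1/8)"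
proof -
  define S where "S = sqrt ((1 - x) / 2)"
  have S: "0 \<le> S" "S < 1" "1 - S\<^sup>2 = (1 + x) / 2" using assms by (auto simp: S_def field_simps)
  have "norm (mehler_integral (2*\<nu>+1) S) \<le> 2 * pi * exp (pi * \<bar>Im \<nu>\<bar>) * (1 - S\<^sup>2) powr (-1/8)"
    unfolding mehler_integral_def
  proof (rule norm_integral_angle_le[OF S(1,2)])
    show "continuous_on {0..pi/2} (mehler_kernel (2*\<nu>+1) S)"
      using S by (intro continuous_on_mehler_kernel_section)
    fix \<phi> :: real assume \<phi>: "0 < \<phi>" "\<phi> < pi/2"
    let ?y = "arcsin (S * sin \<phi>)"
    have y: "0 \<le> ?y" "?y \<le> pi/2" using arcsin_mult_sin_bounds[of S \<phi>] S \<phi> by auto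
    have "norm (cos ((2*\<nu>+1) * of_real ?y)) \<le> exp \<bar>Im ((2*\<nu>+1) * of_real ?y)\<bar>"
      by (rule norm_cos_le_exp_Im)
    also have "\<dots> \<le> exp (pi * \<bar>Im \<nu>\<bar>)"
      using y mult_right_mono[of "2 * ?y" pi "\<bar>Im \<nu>\<bar>"] by (simp add: abs_mult mult_ac)
    finally show "norm (mehler_kernel (2*\<nu>+1) S \<phi>) \<le> exp (pi * \<bar>Im \<nu>\<bar>) / sqrt (1 - (S * sin \<phi>)\<^sup>2)"
      using mult_sin_sq_less_1[OF S(1,2), of \<phi>]
      by (simp add: mehler_kernel_def norm_divide divide_right_mono)
  qed simp
  then have "2 / pi * norm (mehler_integral (2*\<nu>+1) S)
               \<le> 2 / pi * (2 * pi * exp (pi * \<bar>Im \<nu>\<bar>) * ((1 + x) / 2) powr (-1/8))"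
    unfolding S(3) by (intro mult_left_mono) auto
  then show ?thesis
    using legendre_P_eq_mehler_integral[OF assms, of \<nu>]
    by (simp add: S_def norm_mult norm_divide)
qed

lemma mehler_integral_0 [simp]: "mehler_integral \<mu> 0 = of_real pi / 2"
  by (simp add: mehler_integral_def mehler_kernel_def [abs_def] scaleR_conv_of_real)

lemma continuous_on_mehler_integral: "continuous_on {0..<1} (mehler_integral \<mu>)"
  unfolding mehler_integral_def cbox_interval[symmetric]
  by (rule integral_continuous_on_param)
     (rule continuous_on_subset[OF continuous_on_mehler_kernel], auto)

lemma legendre_P_tendsto_1: "(legendre_P \<nu> \<longlongrightarrow> 1) (at_left 1)"
proof -
  have ev: "eventually (\<lambda>x::real. -1 < x \<and> x < 1) (at_left 1)"
    by (rule eventually_mono[OF eventually_at_left_real[of "-1" 1]]) auto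
  have "((\<lambda>x. sqrt ((1 - x) / 2)) \<longlongrightarrow> sqrt ((1 - 1) / 2)) (at_left (1::real))"
    by (auto intro!: tendsto_eq_intros)
  then have "((\<lambda>x. mehler_integral (2*\<nu>+1) (sqrt ((1 - x) / 2))) \<longlongrightarrow> mehler_integral (2*\<nu>+1) 0) (at_left 1)"
    by (intro continuous_on_tendsto_compose[OF continuous_on_mehler_integral])
       (use ev in \<open>auto elim!: eventually_mono\<close>)
  then have "((\<lambda>x. 2 / of_real pi * mehler_integral (2*\<nu>+1) (sqrt ((1 - x) / 2))) \<longlongrightarrow>
               2 / of_real pi * (of_real pi / 2)) (at_left 1)"
    by (intro tendsto_intros) simp
  then have "((\<lambda>x. 2 / of_real pi * mehler_integral (2*\<nu>+1) (sqrt ((1 - x) / 2))) \<longlongrightarrow> 1) (at_left 1)"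
    by simp
  then show ?thesis
  proof (rule Lim_transform_eventually)
    show "\<forall>\<^sub>F x in at_left 1. 2 / of_real pi * mehler_integral (2*\<nu>+1) (sqrt ((1 - x) / 2)) = legendre_P \<nu> x"
      using ev by eventually_elim (simp add: legendre_P_eq_mehler_integral)
  qed
qed

text \<open>
  The sum of \<open>cos ((2 \<nu> + 1) y)\<close> and \<open>cos ((2 \<nu> + 3) y)\<close> contains the factor \<open>cos y\<close>, which cancels the
  denominator of the kernel: the logarithmic singularities of \<open>P\<^sub>\<nu>\<close> and \<open>P\<^sub>\<nu>\<^sub>+\<^sub>1\<close> at \<open>- 1\<close> are opposite, and
  the limit is the integral of \<open>2 cos ((2 \<nu> + 2) \<phi>)\<close> over \<open>[0, \<pi>/2]\<close>, up to the factor \<open>2 / \<pi>\<close>.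
\<close>

lemma legendre_P_add_tendsto:
  assumes "\<nu> \<noteq> -1"
  shows "((\<lambda>x. legendre_P \<nu> x + legendre_P (\<nu> + 1) x) \<longlongrightarrow>
            2 * sin (of_real pi * (\<nu> + 1)) / (of_real pi * (\<nu> + 1))) (at_right (-1))"
proof -
  define k where "k = (\<lambda>S \<phi>. 2 * cos ((2 * \<nu> + 2) * complex_of_real (arcsin (S * sin \<phi>))))"
  define K where "K = (\<lambda>S. integral {0..pi/2} (k S))"
  have kc: "continuous_on ({0..1} \<times> UNIV) (\<lambda>(S, \<phi>). k S \<phi>)"
  proof -
    have *: "- 1 \<le> S * sin \<phi>" "S * sin \<phi> \<le> 1" if "0 \<le> S" "S \<le> 1" for S \<phi> :: real
      using abs_mult_sin_le[of S \<phi>] that by (auto simp: abs_le_iff)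
    show ?thesis unfolding k_def split_beta by (intro continuous_intros) (use * in force)+
  qed
  have Kc: "continuous_on {0..1} K"
    unfolding K_def cbox_interval[symmetric]
    by (rule integral_continuous_on_param) (rule continuous_on_subset[OF kc], auto)
  have sum: "mehler_integral (2*\<nu>+1) S + mehler_integral (2*(\<nu>+1)+1) S = K S" if S: "0 \<le> S" "S < 1" for S
  proof -
    have "mehler_kernel (2*\<nu>+1) S \<phi> + mehler_kernel (2*(\<nu>+1)+1) S \<phi> = k S \<phi>" for \<phi>
    proof -
      define y where "y = complex_of_real (arcsin (S * sin \<phi>))"
      have lt: "(S * sin \<phi>)\<^sup>2 < 1" using S by (rule mult_sin_sq_less_1)
      have "cos y = of_real (cos (arcsin (S * sin \<phi>)))" by (simp add: y_def cos_of_real)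
      also have "cos (arcsin (S * sin \<phi>)) = sqrt (1 - (S * sin \<phi>)\<^sup>2)"
        using lt by (intro cos_arcsin) (auto simp: abs_square_less_1 abs_less_iff)
      finally have cy: "cos y = of_real (sqrt (1 - (S * sin \<phi>)\<^sup>2))" .
      have "cos ((2*\<nu>+1) * y) + cos ((2*(\<nu>+1)+1) * y) = 2 * cos ((2*\<nu>+2) * y) * cos y"
      proof -
        have "(2*\<nu>+1) * y = (2*\<nu>+2) * y - y" "(2*(\<nu>+1)+1) * y = (2*\<nu>+2) * y + y"
          by (simp_all add: algebra_simps)
        then show ?thesis by (simp only: cos_add cos_diff) simp
      qed
      moreover have "cos y \<noteq> 0" using cy lt by simp
      ultimately show ?thesis
        unfolding mehler_kernel_def k_def y_def[symmetric] cy[symmetric]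
        by (simp add: field_simps)
    qed
    then show ?thesis
      unfolding mehler_integral_def K_def
      by (subst integral_add[symmetric])
         (auto intro!: integrable_continuous_real continuous_on_mehler_kernel_section S)
  qed
  have K1: "K 1 = sin (of_real pi * (\<nu> + 1)) / (\<nu> + 1)"
  proof -
    have nz: "2 * \<nu> + 2 \<noteq> 0" 
    proof -
      have "\<nu> + 1 \<noteq> 0" using assms by (simp add: add_eq_0_iff2)
      then have "2 * (\<nu> + 1) \<noteq> 0" by (metis mult_eq_0_iff zero_neq_numeral)
      moreover have "2 * \<nu> + 2 = 2 * (\<nu> + 1)" by (simp add: algebra_simps)
      ultimately show ?thesis by metis
    qed
    have "((\<lambda>\<phi>. 2 * cos ((2*\<nu>+2) * of_real \<phi>)) has_integral
             2 * sin ((2*\<nu>+2) * of_real (pi/2)) / (2*\<nu>+2) - 2 * sin ((2*\<nu>+2) * of_real 0) / (2*\<nu>+2)) {0..pi/2}"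
    proof (rule fundamental_theorem_of_calculus)
      fix \<phi> :: real
      have "((\<lambda>z. 2 * sin (a * z) / a) has_field_derivative 2 * (cos (a * w) * a) / a) (at w)" for a w :: complex
        by (intro DERIV_cdivide DERIV_cmult DERIV_chain2[where f=sin] DERIV_sin DERIV_cmult_Id)
      from this[of "2*\<nu>+2" "of_real \<phi>"]
      have "((\<lambda>z. 2 * sin ((2*\<nu>+2) * z) / (2*\<nu>+2)) has_field_derivative 2 * cos ((2*\<nu>+2) * of_real \<phi>)) (at (of_real \<phi>))"
        using nz by simp
      then show "((\<lambda>\<phi>. 2 * sin ((2*\<nu>+2) * of_real \<phi>) / (2*\<nu>+2)) has_vector_derivative
                    2 * cos ((2*\<nu>+2) * of_real \<phi>)) (at \<phi> within {0..pi/2})"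
        by (rule has_vector_derivative_at_within[OF has_vector_derivative_real_field])
    qed simp
    moreover have "k 1 \<phi> = 2 * cos ((2*\<nu>+2) * of_real \<phi>)" if "\<phi> \<in> {0..pi/2}" for \<phi>
      using that by (simp add: k_def arcsin_sin)
    ultimately have "(k 1 has_integral 2 * sin ((2*\<nu>+2) * of_real (pi/2)) / (2*\<nu>+2)) {0..pi/2}"
      by (subst has_integral_cong[where g="\<lambda>\<phi>. 2 * cos ((2*\<nu>+2) * of_real \<phi>)"]) auto
    then have "K 1 = 2 * sin ((2*\<nu>+2) * of_real (pi/2)) / (2*\<nu>+2)"
      unfolding K_def by (rule integral_unique)
    also have "(2*\<nu>+2) * of_real (pi/2) = of_real pi * (\<nu> + 1)" by (simp add: algebra_simps)
    also have "2 * sin (of_real pi * (\<nu> + 1)) / (2*\<nu>+2) = sin (of_real pi * (\<nu> + 1)) / (\<nu> + 1)"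
      using nz by (simp add: divide_simps)
    finally show ?thesis .
  qed
  have ev: "eventually (\<lambda>x::real. -1 < x \<and> x < 1) (at_right (-1))"
    by (rule eventually_mono[OF eventually_at_right_real[of "-1" 1]]) auto
  have "((\<lambda>x. sqrt ((1 - x) / 2)) \<longlongrightarrow> sqrt ((1 - (-1)) / 2)) (at_right (-1::real))"
    by (auto intro!: tendsto_eq_intros)
  then have "((\<lambda>x. K (sqrt ((1 - x) / 2))) \<longlongrightarrow> K 1) (at_right (-1))"
    by (intro continuous_on_tendsto_compose[OF Kc])
       (use ev in \<open>auto elim!: eventually_mono\<close>)
  then have "((\<lambda>x. 2 / of_real pi * K (sqrt ((1 - x) / 2))) \<longlongrightarrow>
               2 / of_real pi * K 1) (at_right (-1))"
    by (intro tendsto_intros)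
  then have "((\<lambda>x. legendre_P \<nu> x + legendre_P (\<nu> + 1) x) \<longlongrightarrow> 2 / of_real pi * K 1) (at_right (-1))"
  proof (rule Lim_transform_eventually)
    show "\<forall>\<^sub>F x in at_right (-1). 2 / of_real pi * K (sqrt ((1 - x) / 2)) = legendre_P \<nu> x + legendre_P (\<nu> + 1) x"
      using ev
    proof eventually_elim
      case (elim x)
      then have "0 \<le> sqrt ((1 - x) / 2)" "sqrt ((1 - x) / 2) < 1" by auto
      from sum[OF this] elim show ?case
        by (simp only: legendre_P_eq_mehler_integral distrib_left[symmetric])
    qed
  qed
  then show ?thesis by (simp add: K1)
qed

section \<open>The first-order system in \<open>x\<close>\<close>

text \<open>
  The contiguity relation before integration over \<open>\<phi>\<close>: the \<open>S\<close>-derivative of the kernel differs from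
  the combination of the kernels for \<open>\<mu>\<close> and \<open>\<mu> + 2\<close> only by a total \<open>\<phi>\<close>-derivative, that of
  \<open>S cos \<phi> sin ((\<mu> + 1) y) / cos y\<close> with \<open>sin y = S sin \<phi>\<close>. The letters stand for \<open>s = sin \<phi>\<close>, \<open>d = cos \<phi>\<close>,
  \<open>c = cos y\<close>, \<open>C = cos (\<mu> y)\<close> and \<open>Z = sin (\<mu> y)\<close>.
\<close>

lemma mehler_kernel_identity:
  fixes s d c S C Z \<mu> :: complex
  assumes c: "c \<noteq> 0" and cs: "c\<^sup>2 = 1 - S\<^sup>2 * s\<^sup>2" and ds: "d\<^sup>2 = 1 - s\<^sup>2"
  shows "- S * (1 - S\<^sup>2) * ((C * (S * s) - \<mu> * Z * c) * s / c ^ 3) =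
           (\<mu> + 1) / 2 * ((1 - 2 * S\<^sup>2) * (C / c) - (C * (2 * c\<^sup>2 - 1) - Z * (2 * (S * s) * c)) / c) +
           (- S * s * (Z * c + C * (S * s)) / c + S\<^sup>2 * d\<^sup>2 * (\<mu> + 1) * (C * c - Z * (S * s)) / c\<^sup>2 +
            S ^ 3 * s * d\<^sup>2 * (Z * c + C * (S * s)) / c ^ 3)"
proof -
  have "2 * (- S * (1 - S\<^sup>2) * ((C * (S * s) - \<mu> * Z * c) * s)) =
          (\<mu> + 1) * ((1 - 2 * S\<^sup>2) * C - (C * (2 * c\<^sup>2 - 1) - Z * (2 * (S * s) * c))) * c\<^sup>2 +
           2 * (- S * s * (Z * c + C * (S * s)) * c\<^sup>2 + S\<^sup>2 * d\<^sup>2 * (\<mu> + 1) * (C * c - Z * (S * s)) * c +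
            S ^ 3 * s * d\<^sup>2 * (Z * c + C * (S * s)))"
    using cs ds by algebra
  then show ?thesis
    using c by (simp add: divide_simps power2_eq_square power3_eq_cube) (simp add: algebra_simps)
qed

text \<open>
  The \<open>\<phi>\<close>-derivative of \<open>S cos \<phi> sin ((\<mu> + 1) y) / cos y\<close>, as the product and quotient rules produce it
  and in expanded form; here \<open>C\<close> and \<open>Z\<close> are the cosine and sine of \<open>(\<mu> + 1) y\<close>.
\<close>

lemma boundary_term_identity:
  fixes s d c S C Z \<mu> :: complex
  assumes "c \<noteq> 0"
  shows "S * d * ((C * (\<mu> + 1) * (S * d / c) * c - Z * (- (S\<^sup>2 * s * d) / c)) / c\<^sup>2) + - S * s * (Z / c) =
           - S * s * Z / c + S\<^sup>2 * d\<^sup>2 * (\<mu> + 1) * C / c\<^sup>2 + S ^ 3 * s * d\<^sup>2 * Z / c ^ 3"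
proof -
  have 1: "C * (\<mu> + 1) * (S * d / c) * c = C * (\<mu> + 1) * S * d" using assms by simp
  have 2: "Z * (- (S\<^sup>2 * s * d) / c) / c\<^sup>2 = - (Z * S\<^sup>2 * s * d) / c ^ 3"
    by (simp add: power2_eq_square power3_eq_cube mult_ac)
  show ?thesis
    unfolding diff_divide_distrib 1 2 right_diff_distrib
    by (simp add: power2_eq_square power3_eq_cube mult_ac)
qed

lemma has_vector_derivative_complex_div_real:
  fixes f :: "complex \<Rightarrow> complex" and y c :: "real \<Rightarrow> real"
  assumes f: "(f has_field_derivative f') (at (of_real (y t)))"
    and y: "(y has_real_derivative y') (at t)" and c: "(c has_real_derivative c') (at t)" and nz: "c t \<noteq> 0"
  shows "((\<lambda>t. f (of_real (y t)) / of_real (c t)) has_vector_derivative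
           (f' * of_real y' * of_real (c t) - f (of_real (y t)) * of_real c') / (of_real (c t))\<^sup>2) (at t)"
proof -
  have of_real: "((\<lambda>t. complex_of_real (u t)) has_vector_derivative of_real u') (at t)"
    if "(u has_real_derivative u') (at t)" for u u'
    using bounded_linear.has_vector_derivative[OF bounded_linear_of_real] that
    by (simp add: has_real_derivative_iff_has_vector_derivative)
  have F: "((\<lambda>t. f (of_real (y t))) has_vector_derivative of_real y' * f') (at t)"
    using field_vector_diff_chain_at[OF of_real[OF y] f] by (simp add: o_def)
  have "((\<lambda>t. 1 / c t) has_real_derivative - c' / (c t)\<^sup>2) (at t)"
    using DERIV_inverse_fun[OF c nz] by (simp add: divide_inverse power2_eq_square)
  note G = of_real[OF this]
  have "((\<lambda>t. f (of_real (y t)) * of_real (1 / c t)) has_vector_derivative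
           f (of_real (y t)) * of_real (- c' / (c t)\<^sup>2) + of_real y' * f' * of_real (1 / c t)) (at t)"
    by (rule has_vector_derivative_mult[OF F G])
  also have "(\<lambda>t. f (of_real (y t)) * complex_of_real (1 / c t)) = (\<lambda>t. f (of_real (y t)) / of_real (c t))"
    by simp
  also have "f (of_real (y t)) * of_real (- c' / (c t)\<^sup>2) + of_real y' * f' * of_real (1 / c t) =
      (f' * of_real y' * of_real (c t) - f (of_real (y t)) * of_real c') / (of_real (c t))\<^sup>2"
    using nz by (simp add: field_simps power2_eq_square)
  finally show ?thesis .
qed

text \<open>
  Differentiation under the integral sign, followed by \<open>mehler_kernel_identity\<close>: the total derivative
  integrates to zero because \<open>y = 0\<close> at \<open>\<phi> = 0\<close> and \<open>cos \<phi> = 0\<close> at \<open>\<phi> = \<pi>/2\<close>.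
\<close>

lemma mehler_integral_has_vector_derivative:
  assumes S: "0 < S" "S < 1"
  shows "(mehler_integral \<mu> has_vector_derivative
           (\<mu> + 1) / 2 * (mehler_integral (\<mu> + 2) S - of_real (1 - 2 * S\<^sup>2) * mehler_integral \<mu> S) /
             of_real (S * (1 - S\<^sup>2))) (at S)"
proof -
  define c where "c = (\<lambda>S \<phi>. sqrt (1 - (S * sin \<phi>)\<^sup>2))"
  define y where "y = (\<lambda>S \<phi>. arcsin (S * sin \<phi>))"
  define dk where "dk = (\<lambda>S \<phi>. (cos (\<mu> * of_real (y S \<phi>)) * of_real (S * sin \<phi>)
                         - \<mu> * sin (\<mu> * of_real (y S \<phi>)) * of_real (c S \<phi>)) * of_real (sin \<phi>) / of_real (c S \<phi>) ^ 3)"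
  have cpos: "c S \<phi> > 0" and sb: "- 1 < S * sin \<phi>" "S * sin \<phi> < 1" if "0 \<le> S" "S < 1" for S \<phi>
    using mult_sin_sq_less_1[OF that, of \<phi>] abs_mult_sin_le[of S \<phi>] that by (auto simp: c_def abs_le_iff)
  have dkS: "((\<lambda>S. mehler_kernel \<mu> S \<phi>) has_vector_derivative dk S \<phi>) (at S)" if "0 \<le> S" "S < 1" for S \<phi>
  proof -
    have 1: "((\<lambda>S. y S \<phi>) has_real_derivative sin \<phi> / c S \<phi>) (at S)"
      unfolding y_def c_def using sb[OF that, of \<phi>]
      by (auto intro!: derivative_eq_intros simp: divide_inverse)
    have 2: "((\<lambda>S. c S \<phi>) has_real_derivative - (S * (sin \<phi>)\<^sup>2) / c S \<phi>) (at S)"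
      unfolding c_def using mult_sin_sq_less_1[OF that, of \<phi>]
      by (auto intro!: derivative_eq_intros simp: field_simps power2_eq_square)
    have 3: "((\<lambda>z. cos (\<mu> * z)) has_field_derivative - sin (\<mu> * of_real (y S \<phi>)) * \<mu>) (at (of_real (y S \<phi>)))"
      by (intro DERIV_chain2[where f=cos] DERIV_cos DERIV_cmult_Id)
    have "(\<lambda>S. mehler_kernel \<mu> S \<phi>) = (\<lambda>S. cos (\<mu> * of_real (y S \<phi>)) / of_real (c S \<phi>))"
      by (simp add: mehler_kernel_def y_def c_def)
    moreover have "((\<lambda>S. cos (\<mu> * of_real (y S \<phi>)) / of_real (c S \<phi>)) has_vector_derivative dk S \<phi>) (at S)"
      using has_vector_derivative_complex_div_real[OF 3 1 2]
      by (rule has_vector_derivative_eq_rhs)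
         (use cpos[OF that, of \<phi>] in \<open>auto simp: dk_def field_simps power2_eq_square power3_eq_cube\<close>)
    ultimately show ?thesis by simp
  qed
  have dk_cont: "continuous_on ({0<..<1} \<times> cbox 0 (pi/2)) (\<lambda>(S, \<phi>). dk S \<phi>)"
  proof -
    have *: "- 1 \<le> S * sin \<phi>" "S * sin \<phi> \<le> 1" "(S * sin \<phi>)\<^sup>2 \<noteq> 1" if "0 < S" "S < 1" for S \<phi> :: real
      using sb[of S \<phi>] mult_sin_sq_less_1[of S \<phi>] that by auto
    show ?thesis
      unfolding dk_def split_beta y_def c_def
      by (intro continuous_intros) (use * in force)+
  qed
  have leibniz: "(mehler_integral \<mu> has_vector_derivative integral {0..pi/2} (dk S)) (at S)"
  proof -
    have "((\<lambda>S. integral (cbox 0 (pi/2)) (mehler_kernel \<mu> S)) has_vector_derivative integral (cbox 0 (pi/2)) (dk S)) (at S within {0<..<1})"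
    proof (rule leibniz_rule_vector_derivative[OF _ _ dk_cont])
      show "((\<lambda>S. mehler_kernel \<mu> S \<phi>) has_vector_derivative dk S \<phi>) (at S within {0<..<1})"
        if "S \<in> {0<..<1}" for S \<phi>
        using dkS[of S \<phi>, THEN has_vector_derivative_at_within] that by auto
      show "mehler_kernel \<mu> S integrable_on cbox 0 (pi/2)" if "S \<in> {0<..<1}" for S
        using that by (auto intro!: integrable_continuous_real continuous_on_mehler_kernel_section)
    qed (use S in auto)
    then show ?thesis
      using S by (simp add: mehler_integral_def [abs_def] at_within_open[of S "{0<..<1}"])
  qed
  define G' where "G' = (\<lambda>\<phi>. - of_real S * of_real (sin \<phi>) * sin ((\<mu> + 1) * of_real (y S \<phi>)) / of_real (c S \<phi>)
      + (of_real S)\<^sup>2 * (of_real (cos \<phi>))\<^sup>2 * (\<mu> + 1) * cos ((\<mu> + 1) * of_real (y S \<phi>)) / (of_real (c S \<phi>))\<^sup>2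
      + of_real S ^ 3 * of_real (sin \<phi>) * (of_real (cos \<phi>))\<^sup>2 * sin ((\<mu> + 1) * of_real (y S \<phi>)) / of_real (c S \<phi>) ^ 3)"
  have G: "(G' has_integral 0) {0..pi/2}"
  proof -
    define G where "G = (\<lambda>\<phi>. of_real (S * cos \<phi>) * (sin ((\<mu> + 1) * of_real (y S \<phi>)) / of_real (c S \<phi>)))"
    have "(G' has_integral G (pi/2) - G 0) {0..pi/2}"
    proof (rule fundamental_theorem_of_calculus)
      fix \<phi> :: real
      have 1: "((\<lambda>\<phi>. y S \<phi>) has_real_derivative S * cos \<phi> / c S \<phi>) (at \<phi>)"
        unfolding y_def c_def using sb[of S \<phi>] S
        by (auto intro!: derivative_eq_intros simp: divide_inverse)
      have 2: "((\<lambda>\<phi>. c S \<phi>) has_real_derivative - (S\<^sup>2 * sin \<phi> * cos \<phi>) / c S \<phi>) (at \<phi>)"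
        unfolding c_def using mult_sin_sq_less_1[of S \<phi>] S
        by (auto intro!: derivative_eq_intros simp: field_simps power2_eq_square)
      have 3: "((\<lambda>z. sin ((\<mu> + 1) * z)) has_field_derivative cos ((\<mu> + 1) * of_real (y S \<phi>)) * (\<mu> + 1)) (at (of_real (y S \<phi>)))"
        by (intro DERIV_chain2[where f=sin] DERIV_sin DERIV_cmult_Id)
      have 4: "((\<lambda>\<phi>. complex_of_real (S * cos \<phi>)) has_vector_derivative of_real (- S * sin \<phi>)) (at \<phi>)"
        by (rule bounded_linear.has_vector_derivative[OF bounded_linear_of_real])
           (auto intro!: derivative_eq_intros simp: has_real_derivative_iff_has_vector_derivative[symmetric])
      have "complex_of_real (c S \<phi>) \<noteq> 0" using cpos[of S \<phi>] S by simp
      then have eq: "of_real (S * cos \<phi>) *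
           ((cos ((\<mu> + 1) * of_real (y S \<phi>)) * (\<mu> + 1) * of_real (S * cos \<phi> / c S \<phi>) * of_real (c S \<phi>) -
             sin ((\<mu> + 1) * of_real (y S \<phi>)) * of_real (- (S\<^sup>2 * sin \<phi> * cos \<phi>) / c S \<phi>)) / (of_real (c S \<phi>))\<^sup>2) +
           of_real (- S * sin \<phi>) * (sin ((\<mu> + 1) * of_real (y S \<phi>)) / of_real (c S \<phi>)) = G' \<phi>"
        unfolding G'_def of_real_mult of_real_minus of_real_divide of_real_power
        by (rule boundary_term_identity)
      have "c S \<phi> \<noteq> 0" using cpos[of S \<phi>] S by simp
      from has_vector_derivative_mult[OF 4 has_vector_derivative_complex_div_real[OF 3 1 2 this]]
      have "(G has_vector_derivative G' \<phi>) (at \<phi>)"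
        unfolding G_def eq .
      then show "(G has_vector_derivative G' \<phi>) (at \<phi> within {0..pi/2})"
        by (rule has_vector_derivative_at_within)
    qed simp
    moreover have "G (pi/2) = 0" "G 0 = 0" by (simp_all add: G_def y_def)
    ultimately show ?thesis by simp
  qed
  have ident: "- of_real S * (1 - (of_real S)\<^sup>2) * dk S \<phi> =
      (\<mu> + 1) / 2 * (of_real (1 - 2 * S\<^sup>2) * mehler_kernel \<mu> S \<phi> - mehler_kernel (\<mu> + 2) S \<phi>) + G' \<phi>" for \<phi>
  proof -
    define Y where "Y = complex_of_real (y S \<phi>)"
    have lt: "(S * sin \<phi>)\<^sup>2 < 1" using S by (intro mult_sin_sq_less_1) auto
    have sY: "sin Y = of_real S * of_real (sin \<phi>)"
      using sb[of S \<phi>] S by (simp add: Y_def y_def sin_of_real)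
    have "cos (y S \<phi>) = c S \<phi>"
      unfolding y_def c_def using sb[of S \<phi>] S by (intro cos_arcsin) auto
    then have cY: "cos Y = of_real (c S \<phi>)" by (simp add: Y_def cos_of_real)
    have c2: "(complex_of_real (c S \<phi>))\<^sup>2 = 1 - (of_real S)\<^sup>2 * (of_real (sin \<phi>))\<^sup>2"
      using lt by (simp add: c_def power_mult_distrib flip: of_real_power)
    have d2: "(complex_of_real (cos \<phi>))\<^sup>2 = 1 - (of_real (sin \<phi>))\<^sup>2"
      by (simp add: cos_squared_eq flip: of_real_power)
    have t1: "sin ((\<mu> + 1) * Y) = sin (\<mu> * Y) * of_real (c S \<phi>) + cos (\<mu> * Y) * (of_real S * of_real (sin \<phi>))"
      by (simp add: ring_distribs sin_add sY cY)
    have t2: "cos ((\<mu> + 1) * Y) = cos (\<mu> * Y) * of_real (c S \<phi>) - sin (\<mu> * Y) * (of_real S * of_real (sin \<phi>))"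
      by (simp add: ring_distribs cos_add sY cY)
    have t3: "cos ((\<mu> + 2) * Y) = cos (\<mu> * Y) * (2 * (of_real (c S \<phi>))\<^sup>2 - 1)
                 - sin (\<mu> * Y) * (2 * (of_real S * of_real (sin \<phi>)) * of_real (c S \<phi>))"
      by (simp add: ring_distribs cos_add cos_double_cos sin_double sY cY)
    have nz: "complex_of_real (c S \<phi>) \<noteq> 0" using cpos[of S \<phi>] S by simp
    have kernel: "mehler_kernel \<kappa> S \<phi> = cos (\<kappa> * Y) / of_real (c S \<phi>)" for \<kappa>
      by (simp add: mehler_kernel_def Y_def y_def c_def)
    note id = mehler_kernel_identity[OF nz c2 d2, of "cos (\<mu> * Y)" \<mu> "sin (\<mu> * Y)"]
    show ?thesis
      unfolding dk_def G'_def kernel Y_def[symmetric] t1 t2 t3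
        of_real_mult of_real_diff of_real_power of_real_1 of_real_numeral
      by (rule id)
  qed
  define A where "A = (\<mu> + 1) / 2 * (of_real (1 - 2 * S\<^sup>2) * mehler_integral \<mu> S - mehler_integral (\<mu> + 2) S)"
  have ki: "(mehler_kernel \<kappa> S has_integral mehler_integral \<kappa> S) {0..pi/2}" for \<kappa>
    unfolding mehler_integral_def using S
    by (intro integrable_integral integrable_continuous_real continuous_on_mehler_kernel_section) auto
  have "((\<lambda>\<phi>. (\<mu> + 1) / 2 * (of_real (1 - 2 * S\<^sup>2) * mehler_kernel \<mu> S \<phi> - mehler_kernel (\<mu> + 2) S \<phi>) + G' \<phi>) has_integral A + 0) {0..pi/2}"
    unfolding A_def
    by (intro has_integral_add has_integral_mult_right has_integral_diff ki G)
  then have hi: "((\<lambda>\<phi>. - of_real S * (1 - (of_real S)\<^sup>2) * dk S \<phi>) has_integral A) {0..pi/2}"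
    by (simp only: ident add_0_right)
  have nz: "- complex_of_real S * (1 - (of_real S)\<^sup>2) \<noteq> 0"
  proof -
    have "S\<^sup>2 < 1" using S by (simp add: abs_square_less_1)
    then have "complex_of_real (1 - S\<^sup>2) \<noteq> 0" by (simp only: of_real_eq_0_iff)
    then have "1 - (complex_of_real S)\<^sup>2 \<noteq> 0" by simp
    moreover have "complex_of_real S \<noteq> 0" using S by simp
    ultimately show ?thesis by simp
  qed
  have "(dk S has_integral A / (- of_real S * (1 - (of_real S)\<^sup>2))) {0..pi/2}"
    using has_integral_divide[OF hi, of "- of_real S * (1 - (of_real S)\<^sup>2)"]
    by (simp only: nonzero_mult_div_cancel_left[OF nz])
  then have "integral {0..pi/2} (dk S) = A / (- of_real S * (1 - (of_real S)\<^sup>2))"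
    by (rule integral_unique)
  also have "\<dots> = (\<mu> + 1) / 2 * (mehler_integral (\<mu> + 2) S - of_real (1 - 2 * S\<^sup>2) * mehler_integral \<mu> S) /
             of_real (S * (1 - S\<^sup>2))"
  proof -
    have "(\<mu> + 1) / 2 * (mehler_integral (\<mu> + 2) S - of_real (1 - 2 * S\<^sup>2) * mehler_integral \<mu> S) = - A"
      unfolding A_def by (simp only: mult_minus_right[symmetric] minus_diff_eq)
    then show ?thesis by simp
  qed
  finally show ?thesis using leibniz by (simp only:)
qed

lemma legendre_P_has_vector_derivative:
  assumes x: "-1 < x" "x < 1"
  shows "(legendre_P \<nu> has_vector_derivative
           (\<nu> + 1) * (of_real x * legendre_P \<nu> x - legendre_P (\<nu> + 1) x) / of_real (1 - x\<^sup>2)) (at x)"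
proof -
  define S where "S = sqrt ((1 - x) / 2)"
  have S: "0 < S" "S < 1" and S2: "S\<^sup>2 = (1 - x) / 2" using x by (auto simp: S_def)
  have dS: "((\<lambda>x. sqrt ((1 - x) / 2)) has_vector_derivative - 1 / (4 * S)) (at x)"
    unfolding has_real_derivative_iff_has_vector_derivative[symmetric] S_def
    using x by (auto intro!: derivative_eq_intros simp: field_simps)
  define I0 where "I0 = mehler_integral (2*\<nu>+1) S"
  define I1 where "I1 = mehler_integral (2*(\<nu>+1)+1) S"
  have mu: "2 * \<nu> + 1 + 2 = 2 * (\<nu> + 1) + 1" "(2 * \<nu> + 1 + 1) / 2 = \<nu> + 1" by (simp_all add: field_simps)
  have "(mehler_integral (2*\<nu>+1) has_vector_derivative
          (\<nu> + 1) * (I1 - of_real (1 - 2 * S\<^sup>2) * I0) / of_real (S * (1 - S\<^sup>2))) (at S)"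
    using mehler_integral_has_vector_derivative[OF S, of "2*\<nu>+1"] unfolding mu I0_def I1_def .
  then have "((mehler_integral (2*\<nu>+1) \<circ> (\<lambda>x. sqrt ((1 - x) / 2))) has_vector_derivative
               (- 1 / (4 * S)) *\<^sub>R ((\<nu> + 1) * (I1 - of_real (1 - 2 * S\<^sup>2) * I0) / of_real (S * (1 - S\<^sup>2)))) (at x)"
    by (intro vector_diff_chain_at dS) (simp add: S_def)
  then have "((\<lambda>x. 2 / of_real pi * mehler_integral (2*\<nu>+1) (sqrt ((1 - x) / 2))) has_vector_derivative
               2 / of_real pi * ((- 1 / (4 * S)) *\<^sub>R ((\<nu> + 1) * (I1 - of_real (1 - 2 * S\<^sup>2) * I0) / of_real (S * (1 - S\<^sup>2))))) (at x)"
    unfolding o_def by (rule has_vector_derivative_mult_right)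
  then have D: "(legendre_P \<nu> has_vector_derivative
               2 / of_real pi * ((- 1 / (4 * S)) *\<^sub>R ((\<nu> + 1) * (I1 - of_real (1 - 2 * S\<^sup>2) * I0) / of_real (S * (1 - S\<^sup>2))))) (at x)"
    by (rule has_vector_derivative_transform_within_open[of _ _ _ "{-1<..<1}"])
       (use x in \<open>auto simp: legendre_P_eq_mehler_integral\<close>)
  have P: "legendre_P \<nu> x = 2 / of_real pi * I0" "legendre_P (\<nu>+1) x = 2 / of_real pi * I1"
    using x by (simp_all add: legendre_P_eq_mehler_integral I0_def I1_def S_def)
  have x2: "1 - x\<^sup>2 = 4 * S\<^sup>2 * (1 - S\<^sup>2)"
    unfolding S2 by (simp add: power2_eq_square field_simps)
  have xS: "x = 1 - 2 * S\<^sup>2" by (simp add: S2 field_simps)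
  have nz: "complex_of_real S \<noteq> 0" "1 - (complex_of_real S)\<^sup>2 \<noteq> 0"
    using S abs_square_less_1[of S] by (auto simp flip: of_real_power)
  have "2 / of_real pi * ((- 1 / (4 * S)) *\<^sub>R ((\<nu> + 1) * (I1 - of_real (1 - 2 * S\<^sup>2) * I0) / of_real (S * (1 - S\<^sup>2))))
      = (\<nu> + 1) * (of_real x * legendre_P \<nu> x - legendre_P (\<nu> + 1) x) / of_real (1 - x\<^sup>2)"
    unfolding P x2 unfolding xS
    using nz by (simp add: scaleR_conv_of_real divide_simps power2_eq_square) (simp add: algebra_simps)
  with D show ?thesis by simp
qed

lemma legendre_P_minus: "legendre_P (- 1 - \<nu>) x = legendre_P \<nu> x"
proof -
  have "cos ((2 * (- 1 - \<nu>) + 1) * of_real \<beta> / 2) = cos ((2 * \<nu> + 1) * of_real \<beta> / 2)" for \<beta>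
  proof -
    have "(2 * (- 1 - \<nu>) + 1) * of_real \<beta> / 2 = - ((2 * \<nu> + 1) * of_real \<beta> / 2)"
      by (simp add: algebra_simps add_divide_distrib diff_divide_distrib)
    then show ?thesis by (metis cos_minus)
  qed
  then show ?thesis by (simp add: legendre_P_def)
qed

text \<open>
  By the symmetry \<open>legendre_P_minus\<close> this is the preceding relation at degree \<open>- 2 - \<nu>\<close>.
\<close>

lemma legendre_P_Suc_has_vector_derivative:
  assumes x: "-1 < x" "x < 1"
  shows "(legendre_P (\<nu> + 1) has_vector_derivative
           (\<nu> + 1) * (legendre_P \<nu> x - of_real x * legendre_P (\<nu> + 1) x) / of_real (1 - x\<^sup>2)) (at x)"
proof -
  have 1: "legendre_P (- 1 - (\<nu> + 1)) = legendre_P (\<nu> + 1)" by (rule ext) (rule legendre_P_minus)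
  have "legendre_P (- 1 - \<nu>) = legendre_P \<nu>" by (rule ext) (rule legendre_P_minus)
  then have 2: "legendre_P (- 1 - (\<nu> + 1) + 1) = legendre_P \<nu>" by simp
  show ?thesis
    using legendre_P_has_vector_derivative[OF x, of "- 1 - (\<nu> + 1)"] unfolding 1 2
    by (simp add: algebra_simps)
qed

section \<open>Moments of powers of Legendre functions\<close>

definition legendre_bound :: "complex \<Rightarrow> real" where
  "legendre_bound \<nu> = 4 * exp (pi * \<bar>Im \<nu>\<bar>)"

lemma legendre_bound_ge_1: "1 \<le> legendre_bound \<nu>"
proof -
  have "1 \<le> exp (pi * \<bar>Im \<nu>\<bar>)" by simp
  then show ?thesis unfolding legendre_bound_def by linarith
qed

text \<open>
  The factor \<open>legendre_bound \<nu>\<close> serves both degrees, as \<open>\<nu>\<close> and \<open>\<nu> + 1\<close> have the same imaginary part. Lower powers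
  are absorbed into the fourth one because the bound on \<open>P\<^sub>\<nu>\<close> is at least 1.
\<close>

lemma norm_legendre_P_power_le:
  assumes "-1 < x" "x < 1" "i + j \<le> 4"
  shows "norm (legendre_P \<nu> x ^ i * legendre_P (\<nu> + 1) x ^ j) \<le> legendre_bound \<nu> ^ 4 * ((1 + x) / 2) powr (-1/2)"
proof -
  define M where "M = legendre_bound \<nu> * ((1 + x) / 2) powr (-1/8)"
  have t: "0 < (1 + x) / 2" "(1 + x) / 2 \<le> 1" using assms by auto
  have "1 \<le> ((1 + x) / 2) powr (-1/8)"
    using powr_mono'[of "-1/8" 0 "(1 + x) / 2"] t by simp
  then have M1: "1 \<le> M"
    using mult_mono[OF legendre_bound_ge_1[of \<nu>], of 1 "((1 + x) / 2) powr (-1/8)"] legendre_bound_ge_1[of \<nu>]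
    by (simp add: M_def)
  have "norm (legendre_P \<nu> x ^ i * legendre_P (\<nu> + 1) x ^ j) \<le> M ^ i * M ^ j"
    unfolding norm_mult norm_power M_def
    using norm_legendre_P_le[OF assms(1,2), of \<nu>] norm_legendre_P_le[OF assms(1,2), of "\<nu>+1"]
    by (intro mult_mono power_mono) (auto simp: legendre_bound_def)
  also have "\<dots> = M ^ (i + j)" by (simp add: power_add)
  also have "\<dots> \<le> M ^ 4" using assms(3) M1 by (intro power_increasing) auto
  also have "M ^ 4 = legendre_bound \<nu> ^ 4 * ((1 + x) / 2) powr (-1/2)"
    using t powr_power[of "(1 + x) / 2" "-1/8" 4] unfolding M_def power_mult_distrib by simp
  finally show ?thesis .
qed

lemma set_integrable_inverse_sqrt: "set_integrable lborel {-1<..<1} (\<lambda>x::real. ((1 + x) / 2) powr (-1/2))"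
proof -
  have "set_integrable lborel (einterval (ereal (-1)) (ereal 1)) (\<lambda>x::real. ((1 + x) / 2) powr (-1/2))"
  proof (rule interval_integral_FTC_nonneg(1)[where F = "\<lambda>x. 4 * ((1 + x) / 2) powr (1/2)"])
    show "DERIV (\<lambda>x. 4 * ((1 + x) / 2) powr (1/2)) x :> ((1 + x) / 2) powr (-1/2)"
      if "ereal (-1) < ereal x" "ereal x < ereal 1" for x
    proof -
      have t: "0 < (1 + x) / 2" using that by simp
      have "DERIV (\<lambda>x. (1 + x) / 2) x :> 1/2" by (auto intro!: derivative_eq_intros)
      from DERIV_cmult[OF DERIV_fun_powr[OF this t, of "1/2"], of 4] show ?thesis by simp
    qed
    show "isCont (\<lambda>x::real. ((1 + x) / 2) powr (-1/2)) x"
      if "ereal (-1) < ereal x" "ereal x < ereal 1" for x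
      using that by (auto intro!: continuous_intros)
    show "(((\<lambda>x. 4 * ((1 + x) / 2) powr (1/2)) \<circ> real_of_ereal) \<longlongrightarrow> 4 * ((1 + (-1)) / 2) powr (1/2)) (at_right (ereal (-1)))"
      unfolding ereal_tendsto_simps
      by (intro tendsto_intros tendsto_powr') (auto simp: eventually_at_filter)
    show "(((\<lambda>x. 4 * ((1 + x) / 2) powr (1/2)) \<circ> real_of_ereal) \<longlongrightarrow> 4 * ((1 + 1) / 2) powr (1/2)) (at_left (ereal 1))"
      unfolding ereal_tendsto_simps by (intro tendsto_intros) auto
  qed auto
  then show ?thesis by (simp add: einterval_real)
qed

lemma set_integrable_if_le_inverse_sqrt:
  fixes f :: "real \<Rightarrow> complex"
  assumes "continuous_on {-1<..<1} f"
    and "\<And>x. -1 < x \<Longrightarrow> x < 1 \<Longrightarrow> norm (f x) \<le> C * ((1 + x) / 2) powr (-1/2)"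
  shows "set_integrable lborel {-1<..<1} f"
proof (rule set_integrable_bound)
  show "set_integrable lborel {-1<..<1} (\<lambda>x::real. C * ((1 + x) / 2) powr (-1/2))"
    by (intro set_integrable_mult_right set_integrable_inverse_sqrt)
  show "set_borel_measurable lborel {-1<..<1} f"
    unfolding set_borel_measurable_def
    using borel_measurable_continuous_on_indicator[OF _ assms(1)] by simp
  show "AE x in lborel. x \<in> {-1<..<1} \<longrightarrow> norm (f x) \<le> norm (C * ((1 + x) / 2) powr (-1/2))"
    by (intro AE_I2 impI order_trans[OF assms(2)]) auto
qed

lemma isCont_legendre_P:
  assumes "-1 < x" "x < 1" shows "isCont (legendre_P \<nu>) x"
  using has_vector_derivative_continuous[OF legendre_P_has_vector_derivative[OF assms]] .

lemma continuous_on_legendre_P: "continuous_on {-1<..<1} (legendre_P \<nu>)"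
  by (auto intro!: continuous_at_imp_continuous_on isCont_legendre_P)

lemma set_integrable_x_legendre_P_power:
  assumes "k \<le> 4"
  shows "set_integrable lborel {-1<..<1} (\<lambda>x. of_real x * legendre_P \<nu> x ^ k)"
proof (rule set_integrable_if_le_inverse_sqrt)
  show "continuous_on {-1<..<1} (\<lambda>x. of_real x * legendre_P \<nu> x ^ k)"
    by (intro continuous_intros continuous_on_legendre_P)
  fix x :: real assume x: "-1 < x" "x < 1"
  have "norm (of_real x * legendre_P \<nu> x ^ k) \<le> 1 * norm (legendre_P \<nu> x ^ k * legendre_P (\<nu> + 1) x ^ 0)"
    unfolding norm_mult using x by (intro mult_mono) auto
  also have "\<dots> \<le> legendre_bound \<nu> ^ 4 * ((1 + x) / 2) powr (-1/2)"
    using norm_legendre_P_power_le[OF x, of k 0 \<nu>] assms by simp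
  finally show "norm (of_real x * legendre_P \<nu> x ^ k) \<le> legendre_bound \<nu> ^ 4 * ((1 + x) / 2) powr (-1/2)" .
qed

text \<open>
  This disposes of every boundary term at \<open>- 1\<close> that carries a factor \<open>1 + x\<close>.
\<close>

lemma legendre_P_power_tendsto_0:
  assumes "i + j \<le> 4"
  shows "((\<lambda>x. of_real (1 + x) * (legendre_P \<nu> x ^ i * legendre_P (\<nu> + 1) x ^ j)) \<longlongrightarrow> 0) (at_right (-1))"
proof (rule Lim_null_comparison)
  have ev: "eventually (\<lambda>x::real. -1 < x \<and> x < 1) (at_right (-1))"
    by (rule eventually_mono[OF eventually_at_right_real[of "-1" 1]]) auto
  show "\<forall>\<^sub>F x in at_right (-1). norm (of_real (1 + x) * (legendre_P \<nu> x ^ i * legendre_P (\<nu> + 1) x ^ j))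
           \<le> 2 * legendre_bound \<nu> ^ 4 * ((1 + x) / 2) powr (1/2)"
    using ev
  proof eventually_elim
    case (elim x)
    then have x: "-1 < x" "x < 1" by auto
    have "norm (of_real (1 + x) * (legendre_P \<nu> x ^ i * legendre_P (\<nu> + 1) x ^ j))
            \<le> (1 + x) * (legendre_bound \<nu> ^ 4 * ((1 + x) / 2) powr (-1/2))"
      unfolding norm_mult[of "of_real (1 + x)"] norm_of_real
      using x norm_legendre_P_power_le[OF x assms, of \<nu>] by (intro mult_mono) auto
    also have "\<dots> = 2 * legendre_bound \<nu> ^ 4 * (((1 + x) / 2) powr 1 * ((1 + x) / 2) powr (-1/2))"
      using x by (simp add: powr_one)
    also have "((1 + x) / 2) powr 1 * ((1 + x) / 2) powr (-1/2) = ((1 + x) / 2) powr (1 + -1/2)"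
      by (simp only: powr_add)
    finally show ?case by simp
  qed
  have "((\<lambda>x. 2 * legendre_bound \<nu> ^ 4 * ((1 + x) / 2) powr (1/2)) \<longlongrightarrow> 2 * legendre_bound \<nu> ^ 4 * ((1 + (-1)) / 2) powr (1/2)) (at_right (-1))"
    by (intro tendsto_intros tendsto_powr') (auto simp: eventually_at_filter)
  then show "((\<lambda>x. 2 * legendre_bound \<nu> ^ 4 * ((1 + x) / 2) powr (1/2)) \<longlongrightarrow> 0) (at_right (-1))"
    by simp
qed

lemma integral_open_eq_diff_limits:
  fixes F f :: "real \<Rightarrow> complex"
  assumes "\<And>x. -1 < x \<Longrightarrow> x < 1 \<Longrightarrow> (F has_vector_derivative f x) (at x)"
    and "\<And>x. -1 < x \<Longrightarrow> x < 1 \<Longrightarrow> isCont f x"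
    and "set_integrable lborel {-1<..<1} f"
    and "(F \<longlongrightarrow> A) (at_right (-1))" "(F \<longlongrightarrow> B) (at_left 1)"
  shows "(LINT x:{-1<..<1}|lborel. f x) = B - A"
proof -
  have "(LBINT x=ereal (-1)..ereal 1. f x) = B - A"
    by (rule interval_integral_FTC_integrable) (use assms in \<open>auto simp: einterval_real ereal_tendsto_simps\<close>)
  then show ?thesis by (simp add: interval_lebesgue_integral_def einterval_real)
qed

definition legendre_moment :: "nat \<Rightarrow> complex \<Rightarrow> complex" where
  "legendre_moment k \<nu> = (LINT x:{-1<..<1}|lborel. of_real x * legendre_P \<nu> x ^ k)"

lemma has_vector_derivative_power:
  fixes f :: "real \<Rightarrow> complex"
  assumes "(f has_vector_derivative f') (at x)"
  shows "((\<lambda>x. f x ^ n) has_vector_derivative of_nat n * f x ^ (n - 1) * f') (at x)"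
proof -
  have "((\<lambda>z. z ^ n) has_field_derivative of_nat n * f x ^ (n - 1)) (at (f x))"
    by (auto intro!: derivative_eq_intros)
  from field_vector_diff_chain_at[OF assms this] show ?thesis by (simp add: o_def mult_ac)
qed

lemma has_vector_derivative_monomial:
  fixes u v :: "real \<Rightarrow> complex"
  assumes "(u has_vector_derivative u') (at x)" "(v has_vector_derivative v') (at x)"
  shows "((\<lambda>x. u x ^ i * v x ^ j) has_vector_derivative
           u x ^ i * (of_nat j * v x ^ (j - 1) * v') + of_nat i * u x ^ (i - 1) * u' * v x ^ j) (at x)"
  by (intro has_vector_derivative_mult has_vector_derivative_power assms)

lemma has_vector_derivative_complex_of_real: "(complex_of_real has_vector_derivative 1) (at x)"
proof -
  have "((\<lambda>x. complex_of_real x) has_vector_derivative of_real 1) (at x)"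
    by (rule bounded_linear.has_vector_derivative[OF bounded_linear_of_real has_vector_derivative_id])
  then show ?thesis by simp
qed

text \<open>
  The algebraic core. On the left stands the derivative of the quartic form
  \<open>((2m+1) x\<^sup>2 - (3m+1)) v\<^sup>4 + 4m x u v\<^sup>3 - 6m u\<^sup>2 v\<^sup>2 + 4m x u\<^sup>3 v + ((2m-1) x\<^sup>2 - (3m-1)) u\<^sup>4\<close>, where \<open>m = \<nu> + 1\<close>. The
  form comes from the linear system for the coefficients of a quartic form in \<open>u\<close>, \<open>v\<close> with
  coefficients of degree at most 2 in \<open>x\<close>.
\<close>

lemma quartic_certificate:
  fixes m x u v u' v' :: complex
  assumes q: "1 - x\<^sup>2 \<noteq> 0" and u': "u' = m * (x * u - v) / (1 - x\<^sup>2)" and v': "v' = m * (u - x * v) / (1 - x\<^sup>2)"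
  shows "(((2 * m + 1) * x\<^sup>2 - (3 * m + 1)) * (4 * v ^ 3 * v') + (2 * m + 1) * (2 * x) * v ^ 4)
     + (4 * m * x * (u * (3 * v\<^sup>2 * v') + u' * v ^ 3) + 4 * m * (u * v ^ 3))
     - 6 * m * (u\<^sup>2 * (2 * v * v') + 2 * u * u' * v\<^sup>2)
     + (4 * m * x * (u ^ 3 * v' + 3 * u\<^sup>2 * u' * v) + 4 * m * (u ^ 3 * v))
     + (((2 * m - 1) * x\<^sup>2 - (3 * m - 1)) * (4 * u ^ 3 * u') + (2 * m - 1) * (2 * x) * u ^ 4)
     = 2 * ((2 * m + 1)\<^sup>2 * (x * v ^ 4) - (2 * m - 1)\<^sup>2 * (x * u ^ 4))" (is "?L = ?R")
proof -
  have "(1 - x\<^sup>2) * u' = m * (x * u - v)" "(1 - x\<^sup>2) * v' = m * (u - x * v)"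
    using q by (simp_all add: u' v')
  then have "(1 - x\<^sup>2) * ?L = (1 - x\<^sup>2) * ?R" by algebra
  then show ?thesis using q by simp
qed

lemma one_minus_square_nonzero: "-1 < x \<Longrightarrow> x < 1 \<Longrightarrow> 1 - (complex_of_real x)\<^sup>2 \<noteq> 0"
  using of_real_eq_0_iff[of "1 - x\<^sup>2", where ?'a = complex] abs_square_less_1[of x] by auto

text \<open>
  The quartic form vanishes for \<open>x = u = v = 1\<close>, and it equals \<open>- m (u + v)\<^sup>4\<close> plus terms with a factor
  \<open>1 + x\<close>. Hence the recurrence is inhomogeneous only through the limit of \<open>u + v\<close> at \<open>- 1\<close>.
\<close>

theorem legendre_moment_4_recurrence:
  assumes "\<nu> \<noteq> -1"
  shows "(2 * \<nu> + 3)\<^sup>2 * legendre_moment 4 (\<nu> + 1) - (2 * \<nu> + 1)\<^sup>2 * legendre_moment 4 \<nu>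
           = 8 * sin (of_real pi * (\<nu> + 1)) ^ 4 / (of_real pi ^ 4 * (\<nu> + 1) ^ 3)"
proof -
  define m where "m = \<nu> + 1"
  define u where "u = legendre_P \<nu>"
  define v where "v = legendre_P (\<nu> + 1)"
  define l where "l = 2 * sin (of_real pi * m) / (of_real pi * m)"
  define u' where "u' = (\<lambda>x::real. m * (of_real x * u x - v x) / (1 - (of_real x)\<^sup>2))"
  define v' where "v' = (\<lambda>x::real. m * (u x - of_real x * v x) / (1 - (of_real x)\<^sup>2))"
  define c1 where "c1 = (\<lambda>x. (2 * m + 1) * (complex_of_real x)\<^sup>2 - (3 * m + 1))"
  define c2 where "c2 = (\<lambda>x. (2 * m - 1) * (complex_of_real x)\<^sup>2 - (3 * m - 1))"
  define W where "W = (\<lambda>x. c1 x * v x ^ 4 + 4 * m * of_real x * (u x * v x ^ 3) - 6 * m * ((u x)\<^sup>2 * (v x)\<^sup>2)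
                      + 4 * m * of_real x * (u x ^ 3 * v x) + c2 x * u x ^ 4)"
  define f where "f = (\<lambda>x. 2 * ((2 * m + 1)\<^sup>2 * (of_real x * v x ^ 4) - (2 * m - 1)\<^sup>2 * (of_real x * u x ^ 4)))"
  have "m \<noteq> 0" using assms by (simp add: m_def add_eq_0_iff2)
  have W': "(W has_vector_derivative f x) (at x)" if x: "-1 < x" "x < 1" for x
  proof -
    have du: "(u has_vector_derivative u' x) (at x)"
      using legendre_P_has_vector_derivative[OF x, of \<nu>] by (simp add: u_def v_def u'_def m_def)
    have dv: "(v has_vector_derivative v' x) (at x)"
      using legendre_P_Suc_has_vector_derivative[OF x, of \<nu>] by (simp add: u_def v_def v'_def m_def)
    note X = has_vector_derivative_complex_of_real[of x]
    have c: "((\<lambda>x. a * (complex_of_real x)\<^sup>2 - b) has_vector_derivative a * (2 * of_real x)) (at x)" for a b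
      using has_vector_derivative_diff[OF has_vector_derivative_mult_right[OF has_vector_derivative_power[OF X, of 2], of a] has_vector_derivative_const[of b]]
      by simp
    have k: "((\<lambda>x. 4 * m * complex_of_real x) has_vector_derivative 4 * m) (at x)"
      using has_vector_derivative_mult_right[OF X, of "4 * m"] by simp
    note mono = has_vector_derivative_monomial[OF du dv]
    have m04: "((\<lambda>x. v x ^ 4) has_vector_derivative 4 * v x ^ 3 * v' x) (at x)" using mono[of 0 4] by simp
    have m40: "((\<lambda>x. u x ^ 4) has_vector_derivative 4 * u x ^ 3 * u' x) (at x)" using mono[of 4 0] by simp
    have m13: "((\<lambda>x. u x * v x ^ 3) has_vector_derivative u x * (3 * (v x)\<^sup>2 * v' x) + u' x * v x ^ 3) (at x)"
      using mono[of 1 3] by simp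
    have m31: "((\<lambda>x. u x ^ 3 * v x) has_vector_derivative u x ^ 3 * v' x + 3 * (u x)\<^sup>2 * u' x * v x) (at x)"
      using mono[of 3 1] by simp
    have m22: "((\<lambda>x. (u x)\<^sup>2 * (v x)\<^sup>2) has_vector_derivative (u x)\<^sup>2 * (2 * v x * v' x) + 2 * u x * u' x * (v x)\<^sup>2) (at x)"
      using mono[of 2 2] by simp
    have "(W has_vector_derivative
       (c1 x * (4 * v x ^ 3 * v' x) + (2 * m + 1) * (2 * of_real x) * v x ^ 4)
     + (4 * m * of_real x * (u x * (3 * (v x)\<^sup>2 * v' x) + u' x * v x ^ 3) + 4 * m * (u x * v x ^ 3))
     - 6 * m * ((u x)\<^sup>2 * (2 * v x * v' x) + 2 * u x * u' x * (v x)\<^sup>2)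
     + (4 * m * of_real x * (u x ^ 3 * v' x + 3 * (u x)\<^sup>2 * u' x * v x) + 4 * m * (u x ^ 3 * v x))
     + (c2 x * (4 * u x ^ 3 * u' x) + (2 * m - 1) * (2 * of_real x) * u x ^ 4)) (at x)"
      unfolding W_def c1_def c2_def
      by (intro has_vector_derivative_add has_vector_derivative_diff has_vector_derivative_mult
            has_vector_derivative_mult_right[of _ _ _ "6 * m"] c k m04 m40 m13 m31 m22)
    then show ?thesis
      unfolding c1_def c2_def f_def
      by (subst (asm) quartic_certificate[OF one_minus_square_nonzero[OF x] u'_def[THEN fun_cong] v'_def[THEN fun_cong]])
  qed
  have I: "set_integrable lborel {-1<..<1} (\<lambda>x. of_real x * u x ^ 4)" "set_integrable lborel {-1<..<1} (\<lambda>x. of_real x * v x ^ 4)"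
    unfolding u_def v_def by (auto intro!: set_integrable_x_legendre_P_power)
  have "(LINT x:{-1<..<1}|lborel. f x) = 0 - (- m * l ^ 4)"
  proof (rule integral_open_eq_diff_limits[OF W'])
    show "isCont f x" if "-1 < x" "x < 1" for x
      unfolding f_def u_def v_def using that by (intro continuous_intros isCont_legendre_P)
    show "set_integrable lborel {-1<..<1} f"
      unfolding f_def using I by (intro set_integrable_mult_right set_integral_diff) auto
    have z: "((\<lambda>x. of_real (1 + x) * (u x ^ i * v x ^ j)) \<longlongrightarrow> 0) (at_right (-1))" if "i + j \<le> 4" for i j
      unfolding u_def v_def using that by (rule legendre_P_power_tendsto_0)
    have s: "((\<lambda>x. u x + v x) \<longlongrightarrow> l) (at_right (-1))"
      unfolding u_def v_def l_def m_def using legendre_P_add_tendsto[OF assms] by simp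
    \<comment> \<open>This is \<open>W\<close> regrouped so that every term but the last carries a factor \<open>1 + x\<close>.\<close>
    have "((\<lambda>x. (2 * m + 1) * (of_real x - 1) * (of_real (1 + x) * (u x ^ 0 * v x ^ 4)) + 4 * m * (of_real (1 + x) * (u x ^ 1 * v x ^ 3))
             + 4 * m * (of_real (1 + x) * (u x ^ 3 * v x ^ 1)) + (2 * m - 1) * (of_real x - 1) * (of_real (1 + x) * (u x ^ 4 * v x ^ 0))
             - m * (u x + v x) ^ 4) \<longlongrightarrow>
           (2 * m + 1) * (of_real (-1) - 1) * 0 + 4 * m * 0 + 4 * m * 0 + (2 * m - 1) * (of_real (-1) - 1) * 0 - m * l ^ 4) (at_right (-1))"
      by (intro tendsto_intros z s) auto
    moreover have "(\<lambda>x. (2 * m + 1) * (of_real x - 1) * (of_real (1 + x) * (u x ^ 0 * v x ^ 4)) + 4 * m * (of_real (1 + x) * (u x ^ 1 * v x ^ 3))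
             + 4 * m * (of_real (1 + x) * (u x ^ 3 * v x ^ 1)) + (2 * m - 1) * (of_real x - 1) * (of_real (1 + x) * (u x ^ 4 * v x ^ 0))
             - m * (u x + v x) ^ 4) = W"
    proof
      fix x
      define a b y where "a = u x" and "b = v x" and "y = complex_of_real x"
      have "(2 * m + 1) * (y - 1) * ((1 + y) * b ^ 4) + 4 * m * ((1 + y) * (a * b ^ 3))
             + 4 * m * ((1 + y) * (a ^ 3 * b)) + (2 * m - 1) * (y - 1) * ((1 + y) * a ^ 4) - m * (a + b) ^ 4
           = ((2 * m + 1) * y\<^sup>2 - (3 * m + 1)) * b ^ 4 + 4 * m * y * (a * b ^ 3) - 6 * m * (a\<^sup>2 * b\<^sup>2)
                      + 4 * m * y * (a ^ 3 * b) + ((2 * m - 1) * y\<^sup>2 - (3 * m - 1)) * a ^ 4"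
        by algebra
      then show "(2 * m + 1) * (of_real x - 1) * (of_real (1 + x) * (u x ^ 0 * v x ^ 4)) + 4 * m * (of_real (1 + x) * (u x ^ 1 * v x ^ 3))
             + 4 * m * (of_real (1 + x) * (u x ^ 3 * v x ^ 1)) + (2 * m - 1) * (of_real x - 1) * (of_real (1 + x) * (u x ^ 4 * v x ^ 0))
             - m * (u x + v x) ^ 4 = W x"
        unfolding W_def c1_def c2_def a_def b_def y_def
        by (simp only: of_real_add of_real_1 power_0 power_one_right mult_1_left mult_1_right)
    qed
    ultimately show "(W \<longlongrightarrow> - m * l ^ 4) (at_right (-1))" by simp
    have "(W \<longlongrightarrow> ((2 * m + 1) * (of_real 1)\<^sup>2 - (3 * m + 1)) * 1 ^ 4 + 4 * m * of_real 1 * (1 * 1 ^ 3) - 6 * m * (1\<^sup>2 * 1\<^sup>2)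
                      + 4 * m * of_real 1 * (1 ^ 3 * 1) + ((2 * m - 1) * (of_real 1)\<^sup>2 - (3 * m - 1)) * 1 ^ 4) (at_left 1)"
      unfolding W_def c1_def c2_def u_def v_def by (intro tendsto_intros legendre_P_tendsto_1)
    then show "(W \<longlongrightarrow> 0) (at_left 1)" by (simp add: algebra_simps)
  qed
  moreover have "(LINT x:{-1<..<1}|lborel. f x) = 2 * ((2 * m + 1)\<^sup>2 * legendre_moment 4 (\<nu> + 1) - (2 * m - 1)\<^sup>2 * legendre_moment 4 \<nu>)"
    unfolding f_def legendre_moment_def u_def[symmetric] v_def[symmetric] using I by simp
  moreover have "2 * m + 1 = 2 * \<nu> + 3" "2 * m - 1 = 2 * \<nu> + 1" by (simp_all add: m_def)
  ultimately have "2 * ((2 * \<nu> + 3)\<^sup>2 * legendre_moment 4 (\<nu> + 1) - (2 * \<nu> + 1)\<^sup>2 * legendre_moment 4 \<nu>) = m * l ^ 4"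
    by simp
  also have "m * l ^ 4 = 2 * (8 * sin (of_real pi * m) ^ 4 / (of_real pi ^ 4 * m ^ 3))"
    unfolding l_def using \<open>m \<noteq> 0\<close> by (simp add: field_simps eval_nat_numeral)
  finally have "(2 * \<nu> + 3)\<^sup>2 * legendre_moment 4 (\<nu> + 1) - (2 * \<nu> + 1)\<^sup>2 * legendre_moment 4 \<nu>
      = 8 * sin (of_real pi * m) ^ 4 / (of_real pi ^ 4 * m ^ 3)"
    by (metis mult_cancel_left zero_neq_numeral)
  then show ?thesis by (simp add: m_def)
qed

text \<open>
  Legendre's equation makes \<open>((1 - x\<^sup>2) P')\<^sup>2 + \<nu> (\<nu> + 1) (1 - x\<^sup>2) P\<^sup>2\<close> an antiderivative of \<open>- 2 \<nu> (\<nu> + 1) x P\<^sup>2\<close>;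
  in the proof \<open>(1 - x\<^sup>2) P'\<close> is written as \<open>m (x u - v)\<close>.
\<close>

theorem legendre_moment_2:
  assumes "\<nu> \<noteq> -1"
  shows "\<nu> * (\<nu> + 1) * legendre_moment 2 \<nu> = 2 * (sin (of_real pi * (\<nu> + 1)) / of_real pi)\<^sup>2"
proof -
  define m where "m = \<nu> + 1"
  define u where "u = legendre_P \<nu>"
  define v where "v = legendre_P (\<nu> + 1)"
  define l where "l = 2 * sin (of_real pi * m) / (of_real pi * m)"
  define u' where "u' = (\<lambda>x::real. m * (of_real x * u x - v x) / (1 - (of_real x)\<^sup>2))"
  define v' where "v' = (\<lambda>x::real. m * (u x - of_real x * v x) / (1 - (of_real x)\<^sup>2))"
  define W where "W = (\<lambda>x. m\<^sup>2 * (of_real x * u x - v x)\<^sup>2 + (m * (m - 1) - m * (m - 1) * (of_real x)\<^sup>2) * (u x)\<^sup>2)"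
  define f where "f = (\<lambda>x. (- 2 * m * (m - 1)) * (of_real x * (u x)\<^sup>2))"
  have "m \<noteq> 0" using assms by (simp add: m_def add_eq_0_iff2)
  have W': "(W has_vector_derivative f x) (at x)" if x: "-1 < x" "x < 1" for x
  proof -
    have du: "(u has_vector_derivative u' x) (at x)"
      using legendre_P_has_vector_derivative[OF x, of \<nu>] by (simp add: u_def v_def u'_def m_def)
    have dv: "(v has_vector_derivative v' x) (at x)"
      using legendre_P_Suc_has_vector_derivative[OF x, of \<nu>] by (simp add: u_def v_def v'_def m_def)
    note X = has_vector_derivative_complex_of_real[of x]
    have "((\<lambda>x. of_real x * u x - v x) has_vector_derivative (of_real x * u' x + 1 * u x) - v' x) (at x)"
      by (intro has_vector_derivative_diff has_vector_derivative_mult X du dv)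
    from has_vector_derivative_power[OF this, of 2]
    have 1: "((\<lambda>x. (of_real x * u x - v x)\<^sup>2) has_vector_derivative 2 * (of_real x * u x - v x) * (of_real x * u' x + u x - v' x)) (at x)"
      by simp
    have 2: "((\<lambda>x. b - a * (complex_of_real x)\<^sup>2) has_vector_derivative - (a * (2 * of_real x))) (at x)" for a b
      using has_vector_derivative_diff[OF has_vector_derivative_const[of b] has_vector_derivative_mult_right[OF has_vector_derivative_power[OF X, of 2], of a]]
      by simp
    have 3: "((\<lambda>x. (u x)\<^sup>2) has_vector_derivative 2 * u x * u' x) (at x)"
      using has_vector_derivative_power[OF du, of 2] by simp
    have "(W has_vector_derivative m\<^sup>2 * (2 * (of_real x * u x - v x) * (of_real x * u' x + u x - v' x)) +
            ((m * (m - 1) - m * (m - 1) * (of_real x)\<^sup>2) * (2 * u x * u' x) + - (m * (m - 1) * (2 * of_real x)) * (u x)\<^sup>2)) (at x)"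
      unfolding W_def
      by (intro has_vector_derivative_add has_vector_derivative_mult has_vector_derivative_mult_right[of _ _ _ "m\<^sup>2"] 1 2 3)
    moreover have "m\<^sup>2 * (2 * (of_real x * u x - v x) * (of_real x * u' x + u x - v' x)) +
            ((m * (m - 1) - m * (m - 1) * (of_real x)\<^sup>2) * (2 * u x * u' x) + - (m * (m - 1) * (2 * of_real x)) * (u x)\<^sup>2) = f x" (is "?L = _")
    proof -
      have q: "1 - (complex_of_real x)\<^sup>2 \<noteq> 0" by (rule one_minus_square_nonzero[OF x])
      have "(1 - (of_real x)\<^sup>2) * u' x = m * (of_real x * u x - v x)" "(1 - (of_real x)\<^sup>2) * v' x = m * (u x - of_real x * v x)"
        using q by (simp_all add: u'_def v'_def)
      then have "(1 - (of_real x)\<^sup>2) * ?L = (1 - (of_real x)\<^sup>2) * f x" unfolding f_def by algebra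
      then show ?thesis using q by simp
    qed
    ultimately show ?thesis by simp
  qed
  have I: "set_integrable lborel {-1<..<1} (\<lambda>x. of_real x * (u x)\<^sup>2)"
    unfolding u_def by (auto intro!: set_integrable_x_legendre_P_power)
  have "(LINT x:{-1<..<1}|lborel. f x) = 0 - m\<^sup>2 * l\<^sup>2"
  proof (rule integral_open_eq_diff_limits[OF W'])
    show "isCont f x" if "-1 < x" "x < 1" for x
      unfolding f_def u_def v_def using that by (intro continuous_intros isCont_legendre_P)
    show "set_integrable lborel {-1<..<1} f"
      unfolding f_def using I by (intro set_integrable_mult_right) auto
    have z: "((\<lambda>x. of_real (1 + x) * (u x ^ i * v x ^ j)) \<longlongrightarrow> 0) (at_right (-1))" if "i + j \<le> 4" for i j
      unfolding u_def v_def using that by (rule legendre_P_power_tendsto_0)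
    have s: "((\<lambda>x. u x + v x) \<longlongrightarrow> l) (at_right (-1))"
      unfolding u_def v_def l_def m_def using legendre_P_add_tendsto[OF assms] by simp
    have "((\<lambda>x. m\<^sup>2 * (of_real (1 + x) * (u x ^ 1 * v x ^ 0) - (u x + v x))\<^sup>2 + m * (m - 1) * (1 - of_real x) * (of_real (1 + x) * (u x ^ 2 * v x ^ 0))) \<longlongrightarrow>
           m\<^sup>2 * (0 - l)\<^sup>2 + m * (m - 1) * (1 - of_real (-1)) * 0) (at_right (-1))"
      by (intro tendsto_intros z s) auto
    moreover have "(\<lambda>x. m\<^sup>2 * (of_real (1 + x) * (u x ^ 1 * v x ^ 0) - (u x + v x))\<^sup>2 + m * (m - 1) * (1 - of_real x) * (of_real (1 + x) * (u x ^ 2 * v x ^ 0))) = W"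
      unfolding W_def by (rule ext) (simp add: power2_eq_square algebra_simps)
    ultimately show "(W \<longlongrightarrow> m\<^sup>2 * l\<^sup>2) (at_right (-1))" by simp
    have "(W \<longlongrightarrow> m\<^sup>2 * (of_real 1 * 1 - 1)\<^sup>2 + (m * (m - 1) - m * (m - 1) * (of_real 1)\<^sup>2) * 1\<^sup>2) (at_left 1)"
      unfolding W_def u_def v_def by (intro tendsto_intros legendre_P_tendsto_1)
    then show "(W \<longlongrightarrow> 0) (at_left 1)" by simp
  qed
  moreover have "(LINT x:{-1<..<1}|lborel. f x) = (- 2 * m * (m - 1)) * legendre_moment 2 \<nu>"
    unfolding f_def legendre_moment_def u_def[symmetric] by (rule set_integral_mult_right)
  ultimately have "2 * m * (m - 1) * legendre_moment 2 \<nu> = m\<^sup>2 * l\<^sup>2" by simp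
  also have "\<dots> = 4 * (sin (of_real pi * m) / of_real pi)\<^sup>2"
    unfolding l_def using \<open>m \<noteq> 0\<close> by (simp add: power_divide power_mult_distrib)
  finally have "2 * m * (m - 1) * legendre_moment 2 \<nu> = 2 * (2 * (sin (of_real pi * m) / of_real pi)\<^sup>2)" by simp
  moreover have "2 * m * (m - 1) * legendre_moment 2 \<nu> = 2 * (\<nu> * (\<nu> + 1) * legendre_moment 2 \<nu>)"
    using m_def by algebra
  ultimately have "2 * (\<nu> * (\<nu> + 1) * legendre_moment 2 \<nu>) = 2 * (2 * (sin (of_real pi * (\<nu> + 1)) / of_real pi)\<^sup>2)"
    by (simp only: m_def)
  then show ?thesis by (metis mult_cancel_left zero_neq_numeral)
qed

text \<open>
  Since \<open>x\<close> solves Legendre's equation of degree 1, the Wronskian-type expression \<open>(1 - x\<^sup>2) (x P' - P)\<close> is an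
  antiderivative of a multiple of \<open>x P\<close>.
\<close>

theorem legendre_moment_1:
  assumes "\<nu> \<noteq> -1"
  shows "(1 - \<nu>) * (2 + \<nu>) * legendre_moment 1 \<nu> = - 2 * sin (of_real pi * (\<nu> + 1)) / of_real pi"
proof -
  define m where "m = \<nu> + 1"
  define u where "u = legendre_P \<nu>"
  define v where "v = legendre_P (\<nu> + 1)"
  define l where "l = 2 * sin (of_real pi * m) / (of_real pi * m)"
  define u' where "u' = (\<lambda>x::real. m * (of_real x * u x - v x) / (1 - (of_real x)\<^sup>2))"
  define v' where "v' = (\<lambda>x::real. m * (u x - of_real x * v x) / (1 - (of_real x)\<^sup>2))"
  define W where "W = (\<lambda>x. m * of_real x * (of_real x * u x - v x) + (1 * (of_real x)\<^sup>2 - 1) * u x)"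
  define f where "f = (\<lambda>x. ((2 - m) * (m + 1)) * (of_real x * u x))"
  have "m \<noteq> 0" using assms by (simp add: m_def add_eq_0_iff2)
  have W': "(W has_vector_derivative f x) (at x)" if x: "-1 < x" "x < 1" for x
  proof -
    have du: "(u has_vector_derivative u' x) (at x)"
      using legendre_P_has_vector_derivative[OF x, of \<nu>] by (simp add: u_def v_def u'_def m_def)
    have dv: "(v has_vector_derivative v' x) (at x)"
      using legendre_P_Suc_has_vector_derivative[OF x, of \<nu>] by (simp add: u_def v_def v'_def m_def)
    note X = has_vector_derivative_complex_of_real[of x]
    have 1: "((\<lambda>x. of_real x * u x - v x) has_vector_derivative (of_real x * u' x + 1 * u x) - v' x) (at x)"
      by (intro has_vector_derivative_diff has_vector_derivative_mult X du dv)
    have 2: "((\<lambda>x. a * (complex_of_real x)\<^sup>2 - b) has_vector_derivative a * (2 * of_real x)) (at x)" for a b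
      using has_vector_derivative_diff[OF has_vector_derivative_mult_right[OF has_vector_derivative_power[OF X, of 2], of a] has_vector_derivative_const[of b]]
      by simp
    have 3: "((\<lambda>x. m * complex_of_real x) has_vector_derivative m) (at x)"
      using has_vector_derivative_mult_right[OF X, of m] by simp
    have "(W has_vector_derivative (m * of_real x * ((of_real x * u' x + 1 * u x) - v' x) + m * (of_real x * u x - v x)) +
            ((1 * (of_real x)\<^sup>2 - 1) * u' x + 1 * (2 * of_real x) * u x)) (at x)"
      unfolding W_def
      by (intro has_vector_derivative_add has_vector_derivative_mult 1 2 3 du)
    moreover have "(m * of_real x * ((of_real x * u' x + 1 * u x) - v' x) + m * (of_real x * u x - v x)) +
            ((1 * (of_real x)\<^sup>2 - 1) * u' x + 1 * (2 * of_real x) * u x) = f x" (is "?L = _")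
    proof -
      have q: "1 - (complex_of_real x)\<^sup>2 \<noteq> 0" by (rule one_minus_square_nonzero[OF x])
      have "(1 - (of_real x)\<^sup>2) * u' x = m * (of_real x * u x - v x)" "(1 - (of_real x)\<^sup>2) * v' x = m * (u x - of_real x * v x)"
        using q by (simp_all add: u'_def v'_def)
      then have "(1 - (of_real x)\<^sup>2) * ?L = (1 - (of_real x)\<^sup>2) * f x" unfolding f_def by algebra
      then show ?thesis using q by simp
    qed
    ultimately show ?thesis by simp
  qed
  have I: "set_integrable lborel {-1<..<1} (\<lambda>x. of_real x * u x)"
    using set_integrable_x_legendre_P_power[of 1 \<nu>] by (simp add: u_def)
  have "(LINT x:{-1<..<1}|lborel. f x) = 0 - m * l"
  proof (rule integral_open_eq_diff_limits[OF W'])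
    show "isCont f x" if "-1 < x" "x < 1" for x
      unfolding f_def u_def v_def using that by (intro continuous_intros isCont_legendre_P)
    show "set_integrable lborel {-1<..<1} f"
      unfolding f_def using I by (intro set_integrable_mult_right) auto
    have z: "((\<lambda>x. of_real (1 + x) * (u x ^ i * v x ^ j)) \<longlongrightarrow> 0) (at_right (-1))" if "i + j \<le> 4" for i j
      unfolding u_def v_def using that by (rule legendre_P_power_tendsto_0)
    have s: "((\<lambda>x. u x + v x) \<longlongrightarrow> l) (at_right (-1))"
      unfolding u_def v_def l_def m_def using legendre_P_add_tendsto[OF assms] by simp
    have "((\<lambda>x. m * of_real x * (of_real (1 + x) * (u x ^ 1 * v x ^ 0) - (u x + v x)) + (of_real x - 1) * (of_real (1 + x) * (u x ^ 1 * v x ^ 0))) \<longlongrightarrow>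
           m * of_real (-1) * (0 - l) + (of_real (-1) - 1) * 0) (at_right (-1))"
      by (intro tendsto_intros z s) auto
    moreover have "(\<lambda>x. m * of_real x * (of_real (1 + x) * (u x ^ 1 * v x ^ 0) - (u x + v x)) + (of_real x - 1) * (of_real (1 + x) * (u x ^ 1 * v x ^ 0))) = W"
      unfolding W_def by (rule ext) (simp add: power2_eq_square algebra_simps)
    ultimately show "(W \<longlongrightarrow> m * l) (at_right (-1))" by simp
    have "(W \<longlongrightarrow> m * of_real 1 * (of_real 1 * 1 - 1) + (1 * (of_real 1)\<^sup>2 - 1) * 1) (at_left 1)"
      unfolding W_def u_def v_def by (intro tendsto_intros legendre_P_tendsto_1)
    then show "(W \<longlongrightarrow> 0) (at_left 1)" by simp
  qed
  moreover have "(LINT x:{-1<..<1}|lborel. f x) = ((2 - m) * (m + 1)) * legendre_moment 1 \<nu>"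
    unfolding f_def legendre_moment_def u_def[symmetric] using I by simp
  ultimately have "(2 - m) * (m + 1) * legendre_moment 1 \<nu> = - (m * l)" by simp
  also have "m * l = 2 * sin (of_real pi * m) / of_real pi"
    unfolding l_def using \<open>m \<noteq> 0\<close> by simp
  finally show ?thesis by (simp add: m_def algebra_simps)
qed

section \<open>Dependence on the degree\<close>

text \<open>
  A locally dominated integral of holomorphic functions is holomorphic. Cauchy's inequality turns the
  local bound on \<open>f\<close> into a Lipschitz bound, which dominates the difference quotients.
\<close>

lemma holomorphic_on_dominated_integral:
  fixes f :: "complex \<Rightarrow> 'a \<Rightarrow> complex"
  assumes U: "open U"
    and hol: "\<And>x. x \<in> space M \<Longrightarrow> (\<lambda>z. f z x) holomorphic_on U"
    and meas: "\<And>z. z \<in> U \<Longrightarrow> f z \<in> borel_measurable M"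
    and bound: "\<And>z. z \<in> U \<Longrightarrow> \<exists>r>0. \<exists>g. cball z r \<subseteq> U \<and> integrable M g \<and>
                  (\<forall>w\<in>cball z r. \<forall>x\<in>space M. norm (f w x) \<le> g x)"
  shows "(\<lambda>z. \<integral>x. f z x \<partial>M) holomorphic_on U"
proof -
  have "\<exists>D. ((\<lambda>z. \<integral>x. f z x \<partial>M) has_field_derivative D) (at z)" if z: "z \<in> U" for z
  proof -
    obtain r g where r: "0 < r" "cball z r \<subseteq> U" and g: "integrable M g"
      and le: "\<And>w x. w \<in> cball z r \<Longrightarrow> x \<in> space M \<Longrightarrow> norm (f w x) \<le> g x"
      using bound[OF z] by blast
    \<comment> \<open>On the ball of half the radius, circles of radius \<open>r / 2\<close> stay inside \<open>cball z r\<close>, so that Cauchy's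
      inequality bounds the derivative of \<open>f\<close> by the dominating function.\<close>
    define B where "B = ball z (r/2)"
    have Bsub: "B \<subseteq> cball z r" using r by (auto simp: B_def)
    have intg: "integrable M (f w)" if "w \<in> cball z r" for w
      by (rule Bochner_Integration.integrable_bound[OF g meas])
         (use that r le in \<open>auto intro!: AE_I2 order_trans[OF le abs_ge_self]\<close>)
    have deriv_le: "norm (deriv (\<lambda>z. f z x) w) \<le> g x / (r/2)" if x: "x \<in> space M" and w: "w \<in> B" for x w
    proof -
      have sub: "cball w (r/2) \<subseteq> cball z r"
      proof
        fix y assume "y \<in> cball w (r/2)"
        then show "y \<in> cball z r" using w dist_triangle[of z y w] by (auto simp: B_def)
      qed
      have "norm ((deriv ^^ 1) (\<lambda>z. f z x) w) \<le> fact 1 * g x / (r/2) ^ 1"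
      proof (rule Cauchy_inequality)
        have h: "(\<lambda>z. f z x) holomorphic_on cball w (r/2)"
          using hol[OF x] by (rule holomorphic_on_subset) (use sub r in auto)
        then show "(\<lambda>z. f z x) holomorphic_on ball w (r/2)"
          by (rule holomorphic_on_subset) auto
        show "continuous_on (cball w (r/2)) (\<lambda>z. f z x)"
          using h by (rule holomorphic_on_imp_continuous_on)
        show "norm (f y x) \<le> g x" if "norm (w - y) = r/2" for y
          using le[OF _ x, of y] sub that by (auto simp: dist_norm subset_iff)
      qed (use r in auto)
      then show ?thesis by simp
    qed
    have Dw: "((\<lambda>z. f z x) has_field_derivative deriv (\<lambda>z. f z x) w) (at w)" if "x \<in> space M" "w \<in> U" for x w
      using holomorphic_derivI[OF hol[OF that(1)] U that(2)] .
    have lip: "norm (f w x - f z x) \<le> g x / (r/2) * norm (w - z)" if x: "x \<in> space M" and w: "w \<in> B" for x w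
    proof (rule field_differentiable_bound[of B "\<lambda>z. f z x" "deriv (\<lambda>z. f z x)"])
      show "((\<lambda>z. f z x) has_field_derivative deriv (\<lambda>z. f z x) v) (at v within B)" if "v \<in> B" for v
        using Dw[OF x, of v] that Bsub r by (auto intro: has_field_derivative_at_within)
    qed (use deriv_le x w r in \<open>auto simp: B_def\<close>)
    define D where "D = (\<integral>x. deriv (\<lambda>z. f z x) z \<partial>M)"
    have "((\<lambda>w. ((\<integral>x. f w x \<partial>M) - (\<integral>x. f z x \<partial>M)) / (w - z)) \<longlongrightarrow> D) (at z within B)"
    proof (subst tendsto_at_iff_sequentially, intro allI impI)
      fix X assume X: "\<forall>i. X i \<in> B - {z}" and Xz: "X \<longlonglongrightarrow> z"
      have zc: "z \<in> cball z r" using r by simp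
      have Xc: "X i \<in> cball z r" "X i \<noteq> z" "X i \<in> B" for i using X Bsub by auto
      have pt: "(\<lambda>i. (f (X i) x - f z x) / (X i - z)) \<longlonglongrightarrow> deriv (\<lambda>z. f z x) z" if "x \<in> space M" for x
      proof -
        have "((\<lambda>w. (f w x - f z x) / (w - z)) \<longlongrightarrow> deriv (\<lambda>z. f z x) z) (at z)"
          using Dw[OF that z] by (simp add: has_field_derivative_iff)
        then show ?thesis
          using Xz X unfolding tendsto_at_iff_sequentially by (auto simp: o_def)
      qed
      have m: "(\<lambda>x. (f (X i) x - f z x) / (X i - z)) \<in> borel_measurable M" for i
        using meas[of "X i"] meas[OF z] Xc(1)[of i] r by auto
      have "(\<lambda>i. \<integral>x. (f (X i) x - f z x) / (X i - z) \<partial>M) \<longlonglongrightarrow> D"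
        unfolding D_def
      proof (rule integral_dominated_convergence[where w = "\<lambda>x. g x / (r/2)"])
        show "(\<lambda>x. deriv (\<lambda>z. f z x) z) \<in> borel_measurable M"
          by (rule borel_measurable_LIMSEQ_metric[OF m pt])
        show "integrable M (\<lambda>x. g x / (r/2))" using g by simp
        show "AE x in M. norm ((f (X i) x - f z x) / (X i - z)) \<le> g x / (r/2)" for i
          using lip[OF _ Xc(3)[of i]] Xc(2)[of i]
          by (auto intro!: AE_I2 simp: norm_divide pos_divide_le_eq)
      qed (use m pt in \<open>auto intro!: AE_I2\<close>)
      moreover have "(\<integral>x. (f (X i) x - f z x) / (X i - z) \<partial>M) = ((\<integral>x. f (X i) x \<partial>M) - (\<integral>x. f z x \<partial>M)) / (X i - z)" for i
        using intg[OF Xc(1)[of i]] intg[OF zc] by simp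
      ultimately show "((\<lambda>w. ((\<integral>x. f w x \<partial>M) - (\<integral>x. f z x \<partial>M)) / (w - z)) \<circ> X) \<longlonglongrightarrow> D"
        by (simp only: o_def)
    qed
    moreover have "at z within B = at z" by (rule at_within_open) (use r in \<open>auto simp: B_def\<close>)
    ultimately have "((\<lambda>z. \<integral>x. f z x \<partial>M) has_field_derivative D) (at z)"
      by (simp only: has_field_derivative_iff)
    then show ?thesis ..
  qed
  then show ?thesis
    by (metis (no_types) field_differentiable_at_within field_differentiable_def holomorphic_on_def)
qed

lemma holomorphic_legendre_P:
  assumes x: "-1 < x" "x < 1"
  shows "(\<lambda>\<nu>. legendre_P \<nu> x) holomorphic_on UNIV"
proof -
  define S where "S = sqrt ((1 - x) / 2)"
  have S: "0 < S" "S < 1" using x by (auto simp: S_def)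
  define k' where "k' = (\<lambda>\<nu> \<phi>. - sin ((2 * \<nu> + 1) * of_real (arcsin (S * sin \<phi>))) * (2 * of_real (arcsin (S * sin \<phi>)))
                          / complex_of_real (sqrt (1 - (S * sin \<phi>)\<^sup>2)))"
  have *: "- 1 \<le> S * sin \<phi>" "S * sin \<phi> \<le> 1" "(S * sin \<phi>)\<^sup>2 \<noteq> 1" for \<phi> :: real
  proof -
    have "\<bar>S * sin \<phi>\<bar> < 1" using abs_mult_sin_le[of S \<phi>] S by linarith
    then show "- 1 \<le> S * sin \<phi>" "S * sin \<phi> \<le> 1" by linarith+
    show "(S * sin \<phi>)\<^sup>2 \<noteq> 1" using mult_sin_sq_less_1[of S \<phi>] S by auto
  qed
  have "(\<lambda>\<nu>. integral (cbox 0 (pi/2)) (mehler_kernel (2 * \<nu> + 1) S)) holomorphic_on UNIV"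
  proof (rule leibniz_rule_holomorphic[where fx = k'])
    show "((\<lambda>\<nu>. mehler_kernel (2 * \<nu> + 1) S \<phi>) has_field_derivative k' \<nu> \<phi>) (at \<nu> within UNIV)" for \<nu> \<phi>
    proof -
      have "((\<lambda>\<nu>. cos ((2 * \<nu> + 1) * y) / c) has_field_derivative - sin ((2 * \<nu> + 1) * y) * (2 * y) / c) (at \<nu>)" for y c :: complex
        by (rule DERIV_cdivide) (auto intro!: derivative_eq_intros)
      then show ?thesis unfolding mehler_kernel_def k'_def by simp
    qed
    show "mehler_kernel (2 * \<nu> + 1) S integrable_on cbox 0 (pi/2)" for \<nu>
      using S by (auto intro!: integrable_continuous_real continuous_on_mehler_kernel_section)
    show "continuous_on (UNIV \<times> cbox 0 (pi/2)) (\<lambda>(\<nu>, \<phi>). k' \<nu> \<phi>)"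
      unfolding k'_def split_beta by (intro continuous_intros) (use * in auto)
  qed auto
  then have "(\<lambda>\<nu>. 2 / of_real pi * mehler_integral (2 * \<nu> + 1) S) holomorphic_on UNIV"
    unfolding mehler_integral_def cbox_interval by (intro holomorphic_intros)
  then show ?thesis
    using x by (simp add: legendre_P_eq_mehler_integral S_def)
qed

lemma holomorphic_legendre_moment:
  assumes "k \<le> 4"
  shows "legendre_moment k holomorphic_on UNIV"
proof -
  have "(\<lambda>\<nu>. \<integral>x. indicator {-1<..<1} x *\<^sub>R (of_real x * legendre_P \<nu> x ^ k) \<partial>lborel) holomorphic_on UNIV"
  proof (rule holomorphic_on_dominated_integral)
    fix x :: real
    show "(\<lambda>\<nu>. indicator {-1<..<1} x *\<^sub>R (of_real x * legendre_P \<nu> x ^ k)) holomorphic_on UNIV"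
      by (cases "x \<in> {-1<..<1}") (auto intro!: holomorphic_intros holomorphic_legendre_P)
  next
    fix \<nu> :: complex
    show "(\<lambda>x. indicator {-1<..<1} x *\<^sub>R (of_real x * legendre_P \<nu> x ^ k)) \<in> borel_measurable lborel"
      using set_integrable_x_legendre_P_power[OF assms, of \<nu>]
      unfolding set_integrable_def by (rule borel_measurable_integrable)
    define K where "K = 4 * exp (pi * (\<bar>Im \<nu>\<bar> + 1))"
    define g where "g = (\<lambda>x::real. indicator {-1<..<1} x *\<^sub>R (K ^ 4 * ((1 + x) / 2) powr (-1/2)))"
    have g: "integrable lborel g"
      using set_integrable_mult_right[OF set_integrable_inverse_sqrt, of "K ^ 4"]
      unfolding g_def set_integrable_def by simp
    have "norm (indicator {-1<..<1} x *\<^sub>R (of_real x * legendre_P w x ^ k)) \<le> g x" if w: "w \<in> cball \<nu> 1" for w x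
    proof (cases "x \<in> {-1<..<1}")
      case True
      then have x: "-1 < x" "x < 1" by auto
      have "\<bar>Im w\<bar> \<le> \<bar>Im \<nu>\<bar> + 1"
        using abs_Im_le_cmod[of "\<nu> - w"] w by (simp add: dist_norm)
      then have b: "legendre_bound w \<le> K" by (simp add: legendre_bound_def K_def)
      have "norm (of_real x * legendre_P w x ^ k) \<le> 1 * norm (legendre_P w x ^ k * legendre_P (w + 1) x ^ 0)"
        unfolding norm_mult using x by (intro mult_mono) auto
      also have "\<dots> \<le> legendre_bound w ^ 4 * ((1 + x) / 2) powr (-1/2)"
        using norm_legendre_P_power_le[OF x, of k 0 w] assms by simp
      also have "\<dots> \<le> K ^ 4 * ((1 + x) / 2) powr (-1/2)"
        using b legendre_bound_ge_1[of w] by (intro mult_right_mono power_mono) auto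
      finally show ?thesis using True by (simp add: g_def)
    qed (simp add: g_def)
    with g show "\<exists>r>0. \<exists>g. cball \<nu> r \<subseteq> UNIV \<and> integrable lborel g \<and>
        (\<forall>w\<in>cball \<nu> r. \<forall>x\<in>space lborel. norm (indicator {-1<..<1} x *\<^sub>R (of_real x * legendre_P w x ^ k)) \<le> g x)"
      by (intro exI[of _ 1] exI[of _ g]) auto
  qed auto
  then show ?thesis
    by (simp add: legendre_moment_def [abs_def] set_lebesgue_integral_def)
qed

lemma norm_set_integral_le:
  fixes f :: "real \<Rightarrow> complex"
  assumes "continuous_on {-1<..<1} f"
    and "\<And>x. -1 < x \<Longrightarrow> x < 1 \<Longrightarrow> norm (f x) \<le> C * ((1 + x) / 2) powr (-1/2)"
  shows "norm (LINT x:{-1<..<1}|lborel. f x) \<le> C * (LINT x:{-1<..<1}|lborel. ((1 + x) / 2) powr (-1/2))"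
proof -
  have "norm (LINT x:{-1<..<1}|lborel. f x) \<le> (LINT x:{-1<..<1}|lborel. C * ((1 + x) / 2) powr (-1/2))"
    unfolding set_lebesgue_integral_def
  proof (rule Bochner_Integration.integral_norm_bound_integral)
    show "integrable lborel (\<lambda>x. indicator {-1<..<1} x *\<^sub>R f x)"
      using set_integrable_if_le_inverse_sqrt[OF assms] by (simp only: set_integrable_def)
    show "integrable lborel (\<lambda>x::real. indicator {-1<..<1} x *\<^sub>R (C * ((1 + x) / 2) powr (-1/2)))"
      using set_integrable_mult_right[OF set_integrable_inverse_sqrt, of C]
      by (simp only: set_integrable_def)
  qed (use assms(2) in \<open>auto simp: indicator_def\<close>)
  then show ?thesis by simp
qed

lemma legendre_moment_4_growth:
  obtains C where "0 \<le> C" "\<And>\<nu>. norm (legendre_moment 4 \<nu>) \<le> C * exp (4 * pi * \<bar>Im \<nu>\<bar>)"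
proof -
  define c where "c = (LINT x:{-1<..<1}|lborel. ((1 + x::real) / 2) powr (-1/2))"
  have c0: "0 \<le> c" unfolding c_def set_lebesgue_integral_def by (intro integral_nonneg_AE AE_I2) auto
  show ?thesis
  proof
    show "0 \<le> 256 * c" using c0 by simp
    fix \<nu>
    have "norm (legendre_moment 4 \<nu>) \<le> legendre_bound \<nu> ^ 4 * c"
      unfolding legendre_moment_def c_def
    proof (rule norm_set_integral_le)
      show "continuous_on {-1<..<1} (\<lambda>x. of_real x * legendre_P \<nu> x ^ 4)"
        by (intro continuous_intros continuous_on_legendre_P)
      fix x :: real assume x: "-1 < x" "x < 1"
      have "norm (of_real x * legendre_P \<nu> x ^ 4) \<le> 1 * norm (legendre_P \<nu> x ^ 4 * legendre_P (\<nu> + 1) x ^ 0)"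
        unfolding norm_mult using x by (intro mult_mono) auto
      also have "\<dots> \<le> legendre_bound \<nu> ^ 4 * ((1 + x) / 2) powr (-1/2)"
        using norm_legendre_P_power_le[OF x, of 4 0 \<nu>] by simp
      finally show "norm (of_real x * legendre_P \<nu> x ^ 4) \<le> legendre_bound \<nu> ^ 4 * ((1 + x) / 2) powr (-1/2)" .
    qed
    also have "legendre_bound \<nu> ^ 4 = 256 * exp (4 * pi * \<bar>Im \<nu>\<bar>)"
      by (simp add: legendre_bound_def power_mult_distrib mult_ac flip: exp_of_nat_mult)
    finally show "norm (legendre_moment 4 \<nu>) \<le> 256 * c * exp (4 * pi * \<bar>Im \<nu>\<bar>)" by (simp add: mult_ac)
  qed
qed

text \<open>
  For real degree \<open>t\<close> the kernel differs from that of \<open>P\<^sub>0 = 1\<close> by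
  \<open>- 2 sin ((t + 1) y) sin (t y) / cos y\<close>, which is \<open>O(t)\<close> with the same singularity in \<open>\<phi>\<close>.
\<close>

lemma norm_legendre_P_minus_1_le:
  assumes x: "-1 < x" "x < 1"
  shows "norm (legendre_P (of_real t) x - 1) \<le> 4 * pi * \<bar>t\<bar> * ((1 + x) / 2) powr (-1/8)"
proof -
  define S where "S = sqrt ((1 - x) / 2)"
  have S: "0 \<le> S" "S < 1" "1 - S\<^sup>2 = (1 + x) / 2" using x by (auto simp: S_def field_simps)
  define d where "d = (\<lambda>\<phi>. mehler_kernel (2 * of_real t + 1) S \<phi> - 1)"
  have kc: "continuous_on A (mehler_kernel \<mu> S)" for A \<mu>
    using S by (intro continuous_on_mehler_kernel_section)
  have "norm (integral {0..pi/2} d) \<le> 2 * pi * (pi * \<bar>t\<bar>) * (1 - S\<^sup>2) powr (-1/8)"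
  proof (rule norm_integral_angle_le[OF S(1,2)])
    show "continuous_on {0..pi/2} d" unfolding d_def by (intro continuous_intros kc)
    fix \<phi> :: real assume \<phi>: "0 < \<phi>" "\<phi> < pi/2"
    define y where "y = arcsin (S * sin \<phi>)"
    have y: "0 \<le> y" "y \<le> pi/2" using arcsin_mult_sin_bounds[of S \<phi>] S \<phi> by (auto simp: y_def)
    define c where "c = sqrt (1 - (S * sin \<phi>)\<^sup>2)"
    have lt: "(S * sin \<phi>)\<^sup>2 < 1" using S by (intro mult_sin_sq_less_1) auto
    have c: "0 < c" using lt by (simp add: c_def)
    have "cos y = c"
      unfolding y_def c_def using lt by (intro cos_arcsin) (auto simp: abs_square_less_1 abs_less_iff)
    have "cos ((2 * t + 1) * y) - cos y = - 2 * sin ((t + 1) * y) * sin (t * y)"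
    proof -
      have "(2 * t + 1) * y = (t + 1) * y + t * y" "y = (t + 1) * y - t * y" by (simp_all add: algebra_simps)
      then have "cos ((2 * t + 1) * y) - cos y = cos ((t + 1) * y + t * y) - cos ((t + 1) * y - t * y)" by metis
      then show ?thesis by (simp add: cos_add cos_diff)
    qed
    then have "\<bar>cos ((2 * t + 1) * y) - cos y\<bar> = 2 * (\<bar>sin ((t + 1) * y)\<bar> * \<bar>sin (t * y)\<bar>)"
      by (simp add: abs_mult)
    also have "\<dots> \<le> 2 * (1 * \<bar>t * y\<bar>)"
      by (intro mult_left_mono mult_mono abs_sin_le_one abs_sin_x_le_abs_x) auto
    also have "\<dots> \<le> pi * \<bar>t\<bar>"
      using y mult_left_mono[of "2 * y" pi "\<bar>t\<bar>"] by (simp add: abs_mult mult_ac)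
    finally have num: "\<bar>cos ((2 * t + 1) * y) - cos y\<bar> \<le> pi * \<bar>t\<bar>" .
    have "d \<phi> = of_real ((cos ((2 * t + 1) * y) - cos y) / c)"
    proof -
      have "(2 * complex_of_real t + 1) * of_real y = of_real ((2 * t + 1) * y)" by simp
      then have "cos ((2 * complex_of_real t + 1) * of_real y) = of_real (cos ((2 * t + 1) * y))"
        by (metis cos_of_real)
      then show ?thesis
        using c unfolding d_def mehler_kernel_def y_def[symmetric] c_def[symmetric] \<open>cos y = c\<close>
        by (simp add: diff_divide_distrib)
    qed
    then have "norm (d \<phi>) = \<bar>cos ((2 * t + 1) * y) - cos y\<bar> / c"
      using c by (simp only: norm_of_real abs_divide abs_of_pos)
    also have "\<dots> \<le> pi * \<bar>t\<bar> / c" using num c by (intro divide_right_mono) auto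
    finally show "norm (d \<phi>) \<le> pi * \<bar>t\<bar> / sqrt (1 - (S * sin \<phi>)\<^sup>2)" by (simp add: c_def)
  qed simp
  also have "integral {0..pi/2} d = mehler_integral (2 * of_real t + 1) S - of_real pi / 2"
    unfolding d_def mehler_integral_def
    by (subst integral_diff) (auto intro!: integrable_continuous_real kc simp: scaleR_conv_of_real)
  finally have "2 / pi * norm (mehler_integral (2 * of_real t + 1) S - of_real pi / 2) \<le>
                  2 / pi * (2 * pi * (pi * \<bar>t\<bar>) * (1 - S\<^sup>2) powr (-1/8))"
    by (intro mult_left_mono) auto
  moreover have "legendre_P (of_real t) x - 1 = of_real (2 / pi) * (mehler_integral (2 * of_real t + 1) S - of_real pi / 2)"
    using legendre_P_eq_mehler_integral[OF x, of "of_real t"] by (simp add: S_def right_diff_distrib)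
  then have "norm (legendre_P (of_real t) x - 1) = 2 / pi * norm (mehler_integral (2 * of_real t + 1) S - of_real pi / 2)"
    by (simp only: norm_mult norm_of_real) simp
  ultimately show ?thesis unfolding S(3) by simp
qed

text \<open>
  The combination comes from \<open>P\<^sup>4 - 6 P\<^sup>2 + 8 P - 3 = (P - 1)\<^sup>3 (P + 3)\<close>, in which \<open>P - 1\<close> is of order \<open>t\<close>; the
  constant 3 contributes nothing because \<open>x\<close> is odd.
\<close>

lemma legendre_moment_4_near_0:
  obtains C where "\<And>t::real. norm (legendre_moment 4 (of_real t) - 6 * legendre_moment 2 (of_real t)
                       + 8 * legendre_moment 1 (of_real t)) \<le> C * \<bar>t\<bar> ^ 3"
proof
  define c where "c = (LINT x:{-1<..<1}|lborel. ((1 + x::real) / 2) powr (-1/2))"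
  fix t :: real
  define P where "P = legendre_P (of_real t)"
  have I: "set_integrable lborel {-1<..<1} (\<lambda>x. complex_of_real x * P x ^ k)" if "k \<le> 4" for k
    unfolding P_def using that by (rule set_integrable_x_legendre_P_power)
  have I0: "set_integrable lborel {-1<..<1} (\<lambda>x. complex_of_real x)" using I[of 0] by simp
  have I1: "set_integrable lborel {-1<..<1} (\<lambda>x. complex_of_real x * P x)" using I[of 1] by simp
  note I24 = I[of 2] I[of 4]
  have z: "(LINT x:{-1<..<1}|lborel. complex_of_real x) = 0"
  proof -
    have "(LINT x:{-1<..<1}|lborel. complex_of_real x) = (of_real 1)\<^sup>2 / 2 - (of_real (-1))\<^sup>2 / 2"
    proof (rule integral_open_eq_diff_limits)
      show "((\<lambda>x. (complex_of_real x)\<^sup>2 / 2) has_vector_derivative of_real x) (at x)" for x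
        using has_vector_derivative_mult_right[OF has_vector_derivative_power[OF has_vector_derivative_complex_of_real, of 2], of "1/2" x]
        by simp
      show "((\<lambda>x. (complex_of_real x)\<^sup>2 / 2) \<longlongrightarrow> (of_real (-1))\<^sup>2 / 2) (at_right (-1))"
        by (intro tendsto_intros) auto
      show "((\<lambda>x. (complex_of_real x)\<^sup>2 / 2) \<longlongrightarrow> (of_real 1)\<^sup>2 / 2) (at_left 1)"
        by (intro tendsto_intros) auto
    qed (auto intro!: continuous_intros I0)
    then show ?thesis by simp
  qed
  have "(LINT x:{-1<..<1}|lborel. of_real x * ((P x - 1) ^ 3 * (P x + 3)))
      = (LINT x:{-1<..<1}|lborel. of_real x * P x ^ 4 - 6 * (of_real x * P x ^ 2) + 8 * (of_real x * P x) - 3 * complex_of_real x)"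
    by (intro set_lebesgue_integral_cong) (auto simp: algebra_simps eval_nat_numeral)
  also have "\<dots> = legendre_moment 4 (of_real t) - 6 * legendre_moment 2 (of_real t) + 8 * legendre_moment 1 (of_real t) - 3 * 0"
    using I24 I1 I0 unfolding legendre_moment_def P_def[symmetric] z[symmetric] power_one_right
    by (simp add: set_integral_diff set_integral_add)
  finally have eq: "legendre_moment 4 (of_real t) - 6 * legendre_moment 2 (of_real t) + 8 * legendre_moment 1 (of_real t)
      = (LINT x:{-1<..<1}|lborel. of_real x * ((P x - 1) ^ 3 * (P x + 3)))" by simp
  have "norm (LINT x:{-1<..<1}|lborel. of_real x * ((P x - 1) ^ 3 * (P x + 3))) \<le> ((4 * pi * \<bar>t\<bar>) ^ 3 * 7) * c"
    unfolding c_def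
  proof (rule norm_set_integral_le)
    show "continuous_on {-1<..<1} (\<lambda>x. of_real x * ((P x - 1) ^ 3 * (P x + 3)))"
      unfolding P_def by (intro continuous_intros continuous_on_legendre_P)
    fix x :: real assume x: "-1 < x" "x < 1"
    define w where "w = ((1 + x) / 2) powr (-1/8)"
    have w1: "1 \<le> w" using powr_mono'[of "-1/8" 0 "(1 + x) / 2"] x by (simp add: w_def)
    have w4: "w ^ 4 = ((1 + x) / 2) powr (-1/2)"
      using powr_power[of "(1 + x) / 2" "-1/8" 4] x by (simp add: w_def)
    have 1: "norm (P x - 1) \<le> 4 * pi * \<bar>t\<bar> * w"
      using norm_legendre_P_minus_1_le[OF x, of t] by (simp add: P_def w_def)
    have "norm (P x) \<le> 4 * w" using norm_legendre_P_le[OF x, of "of_real t"] by (simp add: P_def w_def)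
    then have 2: "norm (P x + 3) \<le> 7 * w" using norm_triangle_ineq[of "P x" 3] w1 by simp
    have "norm (of_real x * ((P x - 1) ^ 3 * (P x + 3))) \<le> 1 * ((4 * pi * \<bar>t\<bar> * w) ^ 3 * (7 * w))"
      unfolding norm_mult norm_power using x 1 2 w1 by (intro mult_mono power_mono) auto
    also have "\<dots> = (4 * pi * \<bar>t\<bar>) ^ 3 * 7 * w ^ 4"
      by (simp add: power_mult_distrib eval_nat_numeral)
    finally show "norm (of_real x * ((P x - 1) ^ 3 * (P x + 3))) \<le> (4 * pi * \<bar>t\<bar>) ^ 3 * 7 * ((1 + x) / 2) powr (-1/2)"
      unfolding w4 .
  qed
  then show "norm (legendre_moment 4 (of_real t) - 6 * legendre_moment 2 (of_real t) + 8 * legendre_moment 1 (of_real t))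
      \<le> ((4 * pi) ^ 3 * 7 * c) * \<bar>t\<bar> ^ 3"
    unfolding eq by (simp add: power_mult_distrib mult_ac)
qed

section \<open>Polygamma values and even holomorphic functions\<close>

lemma zeta3_sums: "(\<lambda>n. 1 / real (Suc n) ^ 3) sums zeta3"
proof -
  have "summable (\<lambda>n. inverse (real n ^ 3))" by (rule inverse_power_summable) simp
  then have "summable (\<lambda>n. inverse (real (Suc n) ^ 3))" by (subst summable_Suc_iff)
  then show ?thesis unfolding zeta3_def by (simp add: summable_sums inverse_eq_divide)
qed

text \<open>
  The series of \<open>\<psi>''\<close> at \<open>1/2\<close> is \<open>- 16\<close> times the sum of the inverse cubes of the odd numbers, and that sum
  is \<open>7/8\<close> of \<open>\<zeta>(3)\<close>.
\<close>

lemma Polygamma_2_half: "Polygamma 2 (1/2 :: complex) = - 14 * of_real zeta3"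
proof -
  \<comment> \<open>Group the series of \<open>\<zeta>(3)\<close> in pairs and subtract the even half, which is \<open>\<zeta>(3) / 8\<close>.\<close>
  have "(\<lambda>n. sum (\<lambda>n. 1 / real (Suc n) ^ 3) {n * 2..<n * 2 + 2}) sums zeta3"
    by (rule sums_group[OF zeta3_sums]) simp
  then have "(\<lambda>n. 1 / (2 * real n + 1) ^ 3 + 1 / (2 * real n + 2) ^ 3) sums zeta3"
    by (simp add: eval_nat_numeral atLeastLessThanSuc algebra_simps)
  from sums_mult[OF sums_diff[OF this sums_mult[OF zeta3_sums, of "1/8"]], of 8]
  have "(\<lambda>n. 8 * (1 / (2 * real n + 1) ^ 3 + 1 / (2 * real n + 2) ^ 3 - 1/8 * (1 / real (Suc n) ^ 3))) sums (7 * zeta3)"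
    by simp
  also have "(\<lambda>n. 8 * (1 / (2 * real n + 1) ^ 3 + 1 / (2 * real n + 2) ^ 3 - 1/8 * (1 / real (Suc n) ^ 3)))
      = (\<lambda>n. inverse ((1/2 + real n) ^ Suc 2))"
  proof
    fix n
    have 1: "2 * real n + 2 = 2 * (real n + 1)" "2 * real n + 1 = 2 * (1/2 + real n)" by simp_all
    have "8 * (1 / (2 * a) ^ 3 + 1 / (2 * b) ^ 3 - 1/8 * (1 / b ^ 3)) = inverse (a ^ Suc 2)" for a b :: real
      unfolding power_mult_distrib by (simp add: inverse_eq_divide)
    from this[of "1/2 + real n" "real n + 1"]
    show "8 * (1 / (2 * real n + 1) ^ 3 + 1 / (2 * real n + 2) ^ 3 - 1/8 * (1 / real (Suc n) ^ 3)) = inverse ((1/2 + real n) ^ Suc 2)"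
      unfolding 1 by (simp only: of_nat_Suc add.commute)
  qed
  finally have "(\<lambda>n. complex_of_real (inverse ((1/2 + real n) ^ Suc 2))) sums of_real (7 * zeta3)"
    by (rule sums_of_real)
  then have "(\<lambda>n. inverse ((1/2 + of_nat n) ^ Suc 2)) sums (of_real (7 * zeta3) :: complex)"
    by simp
  moreover have "(\<lambda>n. inverse ((1/2 + of_nat n) ^ Suc 2)) sums ((-1) ^ Suc 2 * Polygamma 2 (1/2 :: complex) / fact 2)"
    by (rule Polygamma_LIMSEQ) auto
  ultimately have "of_real (7 * zeta3) = (-1) ^ Suc 2 * Polygamma 2 (1/2 :: complex) / fact 2"
    by (rule sums_unique2)
  then have "Polygamma 2 (1/2 :: complex) = - 2 * of_real (7 * zeta3)"
    by (simp add: fact_2)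
  then show ?thesis by simp
qed

lemma norm_Polygamma_2_le:
  fixes z :: complex
  assumes "1 \<le> Re z"
  shows "norm (Polygamma 2 z) \<le> 2 * zeta3"
proof -
  have nz: "z \<noteq> 0" using assms by auto
  have sums: "(\<lambda>k. inverse ((z + of_nat k) ^ Suc 2)) sums ((-1) ^ Suc 2 * Polygamma 2 z / fact 2)"
    by (rule Polygamma_LIMSEQ[OF nz]) simp
  have "norm (\<Sum>k. inverse ((z + of_nat k) ^ Suc 2)) \<le> (\<Sum>k. 1 / real (Suc k) ^ 3)"
  proof (rule norm_suminf_le)
    fix k
    have "real (Suc k) \<le> Re (z + of_nat k)" using assms by simp
    also have "\<dots> \<le> norm (z + of_nat k)" by (rule complex_Re_le_cmod)
    finally have "real (Suc k) ^ 3 \<le> norm (z + of_nat k) ^ 3" by (intro power_mono) auto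
    then have "inverse (norm (z + of_nat k) ^ 3) \<le> inverse (real (Suc k) ^ 3)" by (intro le_imp_inverse_le) auto
    then show "norm (inverse ((z + of_nat k) ^ Suc 2)) \<le> 1 / real (Suc k) ^ 3"
      by (simp add: norm_inverse norm_power inverse_eq_divide norm_divide)
  qed (use zeta3_sums in \<open>auto simp: sums_iff\<close>)
  also have "\<dots> = zeta3" by (simp add: zeta3_def)
  also have "(\<Sum>k. inverse ((z + of_nat k) ^ Suc 2)) = - Polygamma 2 z / 2"
    using sums by (simp add: sums_iff fact_2)
  finally show ?thesis by (simp add: norm_divide)
qed

lemma holomorphic_factor_zero:
  assumes "f holomorphic_on ball 0 1" "f 0 = (0::complex)"
  obtains g where "g holomorphic_on ball 0 1" "\<And>z. f z = z * g z"
proof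
  show "(\<lambda>z. if z = 0 then deriv f 0 else (f z - f 0) / (z - 0)) holomorphic_on ball 0 1"
    by (rule pole_lemma_open[OF assms(1)]) simp
  show "f z = z * (if z = 0 then deriv f 0 else (f z - f 0) / (z - 0))" for z
    using assms(2) by simp
qed

lemma holomorphic_tendsto_0:
  assumes "f holomorphic_on ball 0 (1::real)"
  shows "(f \<longlongrightarrow> f 0) (at (0::complex))"
proof -
  have "isCont f 0"
    using holomorphic_on_imp_continuous_on[OF assms]
    by (rule continuous_on_interior) simp
  then show ?thesis by (simp add: isCont_def)
qed

lemma odd_holomorphic_zero:
  assumes f: "f holomorphic_on ball 0 1" and odd: "\<And>z. z \<in> ball 0 1 - {0} \<Longrightarrow> f (- z) = - f (z::complex)"
  shows "f 0 = 0"
proof -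
  have f0: "(f \<longlongrightarrow> f 0) (at 0)" by (rule holomorphic_tendsto_0[OF f])
  have "filterlim uminus (at 0) (at (0::complex))"
    by (rule filterlim_atI) (auto intro!: tendsto_eq_intros simp: eventually_at_filter)
  then have "((\<lambda>z. f (- z)) \<longlongrightarrow> f 0) (at 0)" by (rule filterlim_compose[OF f0])
  moreover have "eventually (\<lambda>z. f (- z) = - f z) (at 0)"
  proof -
    have "eventually (\<lambda>z. z \<in> ball 0 1 - {0}) (at (0::complex))"
      by (rule eventually_at_in_open) auto
    then show ?thesis by eventually_elim (rule odd)
  qed
  ultimately have "((\<lambda>z. - f z) \<longlongrightarrow> f 0) (at 0)" by (rule Lim_transform_eventually)
  moreover have "((\<lambda>z. - f z) \<longlongrightarrow> - f 0) (at 0)" by (intro tendsto_intros f0)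
  ultimately have "f 0 = - f 0" by (intro tendsto_unique) auto
  then show ?thesis by (simp add: eq_neg_iff_add_eq_0)
qed

lemma filterlim_of_real_at_right_0: "filterlim of_real (at (0::complex)) (at_right 0)"
  by (rule filterlim_atI)
     (auto intro!: tendsto_eq_intros simp: eventually_at_filter)

text \<open>
  Evenness excludes odd powers from the expansion of \<open>f\<close> at 0, and the limit along the positive axis
  excludes the powers 0 and 2. The zeros are split off one at a time.
\<close>

lemma even_holomorphic_factor_fourth_power:
  fixes f :: "complex \<Rightarrow> complex"
  assumes f: "f holomorphic_on ball 0 1"
    and even: "\<And>z. z \<in> ball 0 1 - {0} \<Longrightarrow> f (- z) = f z"
    and lim: "((\<lambda>t. f (of_real t) / (of_real t)\<^sup>2) \<longlongrightarrow> 0) (at_right 0)"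
  obtains g where "g holomorphic_on ball 0 1" "\<And>z. f z = z ^ 4 * g z"
proof -
  have ev: "eventually (\<lambda>t::real. t \<noteq> 0) (at_right 0)" by (simp add: eventually_at_filter)
  have real_lim: "((\<lambda>t. h (of_real t)) \<longlongrightarrow> h 0) (at_right 0)" if "h holomorphic_on ball 0 1" for h :: "complex \<Rightarrow> complex"
    by (rule filterlim_compose[OF holomorphic_tendsto_0[OF that] filterlim_of_real_at_right_0])
  have t0: "((\<lambda>t. (complex_of_real t)\<^sup>2) \<longlongrightarrow> 0) (at_right 0)" by (auto intro!: tendsto_eq_intros)
  have "((\<lambda>t. (of_real t)\<^sup>2 * (f (of_real t) / (of_real t)\<^sup>2)) \<longlongrightarrow> 0 * 0) (at_right 0)"
    by (intro tendsto_mult t0 lim)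
  then have "((\<lambda>t. f (of_real t)) \<longlongrightarrow> 0 * 0) (at_right 0)"
    by (rule Lim_transform_eventually) (use ev in eventually_elim, simp)
  then have "f 0 = 0" using real_lim[OF f] tendsto_unique[of "at_right (0::real)"] by fastforce
  then obtain g1 where g1: "g1 holomorphic_on ball 0 1" "\<And>z. f z = z * g1 z"
    using holomorphic_factor_zero[OF f] by blast
  have odd1: "g1 (- z) = - g1 z" if "z \<in> ball 0 1 - {0}" for z
  proof -
    have "z * g1 (- z) = z * (- g1 z)"
      using even[OF that] unfolding g1(2) by (metis mult_minus_left mult_minus_right minus_minus)
    then show ?thesis using that unfolding mult_cancel_left by auto
  qed
  obtain g2 where g2: "g2 holomorphic_on ball 0 1" "\<And>z. g1 z = z * g2 z"
    using holomorphic_factor_zero[OF g1(1) odd_holomorphic_zero[OF g1(1) odd1]] by blast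
  have even2: "g2 (- z) = g2 z" if "z \<in> ball 0 1 - {0}" for z
    using odd1[OF that] that unfolding g2(2) by simp
  have "((\<lambda>t. g2 (of_real t)) \<longlongrightarrow> 0) (at_right 0)"
    using lim by (rule Lim_transform_eventually)
      (use ev in eventually_elim, simp add: g1(2) g2(2) power2_eq_square)
  then have "g2 0 = 0" using real_lim[OF g2(1)] tendsto_unique[of "at_right (0::real)"] by fastforce
  then obtain g3 where g3: "g3 holomorphic_on ball 0 1" "\<And>z. g2 z = z * g3 z"
    using holomorphic_factor_zero[OF g2(1)] by blast
  have odd3: "g3 (- z) = - g3 z" if "z \<in> ball 0 1 - {0}" for z
  proof -
    have "z * g3 (- z) = z * (- g3 z)"
      using even2[OF that] unfolding g3(2) by (metis mult_minus_left mult_minus_right minus_minus)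
    then show ?thesis using that unfolding mult_cancel_left by auto
  qed
  obtain g4 where g4: "g4 holomorphic_on ball 0 1" "\<And>z. g3 z = z * g4 z"
    using holomorphic_factor_zero[OF g3(1) odd_holomorphic_zero[OF g3(1) odd3]] by blast
  show ?thesis
    by (rule that[OF g4(1)]) (simp add: g1(2) g2(2) g3(2) g4(2) eval_nat_numeral mult_ac)
qed

section \<open>The defect: symmetries and growth\<close>

text \<open>
  Let \<open>g\<close> be \<open>\<pi>\<^sup>4/2 (2 t + 1)\<^sup>2 (6 M\<^sub>2 - 8 M\<^sub>1) - 2 sin\<^sup>4 (\<pi> t) / t\<^sup>3\<close>, where \<open>M\<^sub>1\<close> and \<open>M\<^sub>2\<close> are the values of
  the first two moments at degree \<open>t\<close>. The subtracted term is the leading part of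
  \<open>sin\<^sup>4 (\<pi> t) \<psi>'' (- t)\<close>. The limit says that \<open>g\<close> is \<open>o(t\<^sup>2)\<close>: the linear terms cancel, and so do the
  quadratic ones.
\<close>

lemma real_defect_limit:
  "((\<lambda>t::real. pi ^ 4 / 2 * (2 * t + 1)\<^sup>2 / t\<^sup>2 *
       (12 * (sin (pi * t))\<^sup>2 / (pi\<^sup>2 * t * (t + 1)) - 16 * sin (pi * t) / (pi * (1 - t) * (2 + t)))
     - 2 * sin (pi * t) ^ 4 / t ^ 5) \<longlongrightarrow> 0) (at_right 0)"
  by real_asymp (simp add: field_simps)

definition defect :: "complex \<Rightarrow> complex" where
  "defect \<nu> = of_real pi ^ 4 * (2 * \<nu> + 1)\<^sup>2 * legendre_moment 4 \<nu> / (2 * sin (of_real pi * \<nu>) ^ 4)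
     - (Polygamma 2 (\<nu> + 1) + Polygamma 2 (- \<nu>) + 28 * of_real zeta3)"

lemma sin_pi_eq_0_iff: "sin (of_real pi * \<nu>) = 0 \<longleftrightarrow> \<nu> \<in> \<int>" for \<nu> :: complex
proof -
  have "of_real pi * \<nu> = of_real (of_int n * pi) \<longleftrightarrow> \<nu> = of_int n" for n
  proof -
    have "complex_of_real (of_int n * pi) = of_real pi * of_int n" by simp
    then show ?thesis by (simp only: mult_cancel_left of_real_eq_0_iff pi_neq_zero simp_thms)
  qed
  then show ?thesis unfolding sin_eq_0 Ints_def by auto
qed

lemma sin_pi_plus_1: "sin (of_real pi * (\<nu> + 1)) = - sin (of_real pi * \<nu>)" for \<nu> :: complex
  by (simp add: ring_distribs sin_add flip: sin_of_real cos_of_real)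

lemma Polygamma_2_plus1: "z \<noteq> 0 \<Longrightarrow> Polygamma 2 (z + 1) = Polygamma 2 z + 2 / z ^ 3" for z :: complex
  using Polygamma_plus1[of z 2] by (simp add: fact_2)

lemma defect_plus_1:
  assumes "\<nu> \<notin> \<int>"
  shows "defect (\<nu> + 1) = defect \<nu>"
proof -
  have n1: "\<nu> \<noteq> -1" using assms by (metis Ints_1 Ints_minus)
  then have n1': "\<nu> + 1 \<noteq> 0" by (simp add: add_eq_0_iff2)
  have s: "sin (of_real pi * \<nu>) \<noteq> 0" using assms by (simp add: sin_pi_eq_0_iff)
  define s where "s = sin (of_real pi * \<nu>)"
  have 1: "Polygamma 2 (\<nu> + 1 + 1) = Polygamma 2 (\<nu> + 1) + 2 / (\<nu> + 1) ^ 3"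
    using n1' by (rule Polygamma_2_plus1)
  have "- (\<nu> + 1) \<noteq> 0" using n1' by (simp only: neg_equal_0_iff_equal not_False_eq_True)
  from Polygamma_2_plus1[OF this]
  have "Polygamma 2 (- (\<nu> + 1) + 1) = Polygamma 2 (- (\<nu> + 1)) + 2 / (- (\<nu> + 1)) ^ 3" .
  moreover have "- (\<nu> + 1) + 1 = - \<nu>" by simp
  moreover have "2 / (- w) ^ 3 = - (2 / w ^ 3)" for w :: complex by (simp add: power3_eq_cube)
  note this[of "\<nu> + 1"]
  ultimately have 2: "Polygamma 2 (- (\<nu> + 1)) = Polygamma 2 (- \<nu>) + 2 / (\<nu> + 1) ^ 3" by simp
  have rec: "(2 * (\<nu> + 1) + 1)\<^sup>2 * legendre_moment 4 (\<nu> + 1) = (2 * \<nu> + 1)\<^sup>2 * legendre_moment 4 \<nu> + 8 * s ^ 4 / (of_real pi ^ 4 * (\<nu> + 1) ^ 3)"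
  proof -
    have "2 * (\<nu> + 1) + 1 = 2 * \<nu> + 3" by simp
    moreover have "sin (of_real pi * (\<nu> + 1)) ^ 4 = s ^ 4" by (simp add: sin_pi_plus_1 s_def)
    ultimately show ?thesis
      using legendre_moment_4_recurrence[OF n1] by (metis diff_eq_eq add.commute)
  qed
  have "of_real pi ^ 4 * ((2 * (\<nu> + 1) + 1)\<^sup>2 * legendre_moment 4 (\<nu> + 1)) / (2 * s ^ 4)
      = of_real pi ^ 4 * ((2 * \<nu> + 1)\<^sup>2 * legendre_moment 4 \<nu>) / (2 * s ^ 4) + 4 / (\<nu> + 1) ^ 3"
  proof -
    have "p * (a + 8 * q / (p * d)) / (2 * q) = p * a / (2 * q) + 4 / d" if "p \<noteq> 0" "q \<noteq> 0" "d \<noteq> 0" for p a q d :: complex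
      using that by (simp add: field_simps)
    then show ?thesis unfolding rec using s n1' by (simp add: s_def)
  qed
  moreover have "sin (of_real pi * (\<nu> + 1)) ^ 4 = s ^ 4" by (simp add: sin_pi_plus_1 s_def)
  ultimately show ?thesis
    unfolding defect_def 1 2 s_def[symmetric] mult.assoc by simp
qed

lemma defect_reflect: "defect (- 1 - \<nu>) = defect \<nu>"
proof -
  have "legendre_moment 4 (- 1 - \<nu>) = legendre_moment 4 \<nu>"
    by (simp add: legendre_moment_def legendre_P_minus)
  moreover have "(2 * (- 1 - \<nu>) + 1)\<^sup>2 = (2 * \<nu> + 1)\<^sup>2" by algebra
  moreover have "sin (of_real pi * (- 1 - \<nu>)) ^ 4 = sin (of_real pi * \<nu>) ^ 4"
  proof -
    have "of_real pi * (- 1 - \<nu>) = - (of_real pi * (\<nu> + 1))" by (simp add: algebra_simps)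
    then have "sin (of_real pi * (- 1 - \<nu>)) = sin (of_real pi * \<nu>)" by (simp only: sin_minus sin_pi_plus_1) simp
    then show ?thesis by simp
  qed
  moreover have "- 1 - \<nu> + 1 = - \<nu>" "- (- 1 - \<nu>) = \<nu> + 1" by simp_all
  ultimately show ?thesis unfolding defect_def by simp
qed

lemma defect_even:
  assumes "\<nu> \<notin> \<int>" shows "defect (- \<nu>) = defect \<nu>"
proof -
  have nu: "\<nu> - 1 \<notin> \<int>" using assms Ints_add[of "\<nu> - 1" 1] by auto
  have "defect (- \<nu>) = defect (- 1 - (\<nu> - 1))" by simp
  also have "\<dots> = defect (\<nu> - 1)" by (rule defect_reflect)
  also have "\<dots> = defect \<nu>" using defect_plus_1[OF nu] by simp
  finally show ?thesis .
qed

lemma not_Ints_imp_not_nonpos_Ints: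
  assumes "\<nu> \<notin> \<int>" shows "\<nu> + 1 \<notin> \<int>\<^sub>\<le>\<^sub>0" "- \<nu> \<notin> \<int>\<^sub>\<le>\<^sub>0"
proof -
  have "\<nu> + 1 \<notin> \<int>" using assms Ints_diff[of "\<nu> + 1" 1] by auto
  then show "\<nu> + 1 \<notin> \<int>\<^sub>\<le>\<^sub>0" using nonpos_Ints_Int by blast
  show "- \<nu> \<notin> \<int>\<^sub>\<le>\<^sub>0" using assms nonpos_Ints_Int[of "- \<nu>"] by auto
qed

lemma holomorphic_on_Polygamma_compose:
  fixes h :: "complex \<Rightarrow> complex"
  assumes "h holomorphic_on A" "\<And>z. z \<in> A \<Longrightarrow> h z \<notin> \<int>\<^sub>\<le>\<^sub>0"
  shows "(\<lambda>z. Polygamma n (h z)) holomorphic_on A"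
proof -
  have "(Polygamma n \<circ> h) holomorphic_on A"
    by (rule holomorphic_on_compose_gen[OF assms(1) holomorphic_on_Polygamma[of "- \<int>\<^sub>\<le>\<^sub>0"]]) (use assms(2) in auto)
  then show ?thesis by (simp add: o_def)
qed

lemma holomorphic_defect: "defect holomorphic_on - \<int>"
proof -
  have M: "legendre_moment 4 holomorphic_on - \<int>"
    using holomorphic_legendre_moment[of 4] by (rule holomorphic_on_subset) auto
  have "(\<lambda>\<nu>. Polygamma 2 (\<nu> + 1)) holomorphic_on - (\<int> :: complex set)"
    by (rule holomorphic_on_Polygamma_compose) (auto intro!: holomorphic_intros dest: not_Ints_imp_not_nonpos_Ints)
  moreover have "(\<lambda>\<nu>. Polygamma 2 (- \<nu>)) holomorphic_on - (\<int> :: complex set)"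
    by (rule holomorphic_on_Polygamma_compose) (auto intro!: holomorphic_intros dest: not_Ints_imp_not_nonpos_Ints)
  ultimately show ?thesis
    unfolding defect_def [abs_def] using M
    by (auto intro!: holomorphic_intros simp: sin_pi_eq_0_iff)
qed

text \<open>
  Away from the real axis \<open>sin\<^sup>4 (\<pi> \<nu>)\<close> is, up to a constant factor, as large as the bound on the fourth
  moment, and both
  polygamma terms are bounded once they are shifted to real part at least 1.
\<close>

lemma defect_bound_strip:
  obtains K where "0 \<le> K" "\<And>\<nu>. 0 \<le> Re \<nu> \<Longrightarrow> Re \<nu> \<le> 1 \<Longrightarrow> 1 \<le> \<bar>Im \<nu>\<bar> \<Longrightarrow> norm (defect \<nu>) \<le> K * (1 + norm \<nu>)\<^sup>2"
proof -
  obtain C where C: "0 \<le> C" "\<And>\<nu>. norm (legendre_moment 4 \<nu>) \<le> C * exp (4 * pi * \<bar>Im \<nu>\<bar>)"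
    by (rule legendre_moment_4_growth) blast
  have z0: "0 \<le> zeta3" using order_trans[OF norm_ge_zero norm_Polygamma_2_le[of 1]] by simp
  \<comment> \<open>\<open>512 = 2\<^sup>2 4\<^sup>4 / 2\<close> comes from \<open>\<bar>2 \<nu> + 1\<bar> \<le> 2 (1 + \<bar>\<nu>\<bar>)\<close> and \<open>\<bar>sin (\<pi> \<nu>)\<bar> \<ge> exp (\<pi> \<bar>Im \<nu>\<bar>) / 4\<close>; the summand 4
    comes from the two shifts that bring the argument \<open>- \<nu>\<close> to real part at least 1.\<close>
  define K where "K = 512 * pi ^ 4 * C + (32 * zeta3 + 4)"
  show ?thesis
  proof
    show "0 \<le> K" using C(1) z0 by (simp add: K_def)
    fix \<nu> :: complex assume \<nu>: "0 \<le> Re \<nu>" "Re \<nu> \<le> 1" "1 \<le> \<bar>Im \<nu>\<bar>"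
    define Y where "Y = pi * \<bar>Im \<nu>\<bar>"
    have Y: "1 \<le> Y"
      using \<nu>(3) pi_gt3 mult_mono[of 1 pi 1 "\<bar>Im \<nu>\<bar>"] by (simp add: Y_def)
    have "1 \<le> norm \<nu>" using \<nu>(3) abs_Im_le_cmod[of \<nu>] by linarith
    have "1 \<le> norm (1 - \<nu>)" using \<nu>(3) abs_Im_le_cmod[of "1 - \<nu>"] by simp
    have sin_ge: "exp Y / 4 \<le> norm (sin (of_real pi * \<nu>))"
    proof -
      define z where "z = of_real pi * \<nu>"
      have Im: "\<bar>Im z\<bar> = Y" by (simp add: z_def Y_def abs_mult)
      have "norm (sin z) = norm (exp (\<i> * z) - exp (- (\<i> * z))) / 2"
        by (simp add: sin_exp_eq norm_divide norm_mult)
      moreover have "\<bar>norm (exp (\<i> * z)) - norm (exp (- (\<i> * z)))\<bar> \<le> norm (exp (\<i> * z) - exp (- (\<i> * z)))"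
        by (rule norm_triangle_ineq3)
      moreover have "\<bar>norm (exp (\<i> * z)) - norm (exp (- (\<i> * z)))\<bar> = \<bar>exp (- Im z) - exp (Im z)\<bar>"
        by simp
      moreover have "\<bar>exp (- Im z) - exp (Im z)\<bar> = exp Y - exp (- Y)"
        using Im Y by (cases "0 \<le> Im z") auto
      moreover have "exp (- Y) \<le> exp Y / 2"
      proof -
        have "exp (- Y) * 2 \<le> exp (- Y) * exp (2 * Y)"
        proof (rule mult_left_mono)
          show "2 \<le> exp (2 * Y)" using exp_ge_add_one_self[of "2 * Y"] Y by linarith
        qed simp
        also have "\<dots> = exp Y" by (simp flip: exp_add)
        finally show ?thesis by simp
      qed
      ultimately have "exp Y / 4 \<le> norm (sin z)" by linarith
      then show ?thesis by (simp add: z_def)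
    qed
    have "norm (of_real pi ^ 4 * (2 * \<nu> + 1)\<^sup>2 * legendre_moment 4 \<nu> / (2 * sin (of_real pi * \<nu>) ^ 4))
        = pi ^ 4 * norm (2 * \<nu> + 1) ^ 2 * norm (legendre_moment 4 \<nu>) / (2 * norm (sin (of_real pi * \<nu>)) ^ 4)"
      by (simp add: norm_mult norm_divide norm_power)
    also have "\<dots> \<le> pi ^ 4 * (2 * (1 + norm \<nu>)) ^ 2 * (C * exp (4 * Y)) / (2 * (exp Y / 4) ^ 4)"
    proof (intro frac_le mult_mono power_mono)
      have "norm (2 * \<nu> + 1) \<le> norm (2 * \<nu>) + norm (1::complex)" by (rule norm_triangle_ineq)
      then show "norm (2 * \<nu> + 1) \<le> 2 * (1 + norm \<nu>)" by (simp add: norm_mult)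
      show "norm (legendre_moment 4 \<nu>) \<le> C * exp (4 * Y)" using C(2)[of \<nu>] by (simp add: Y_def mult_ac)
    qed (use sin_ge C(1) in auto)
    also have "\<dots> = 512 * pi ^ 4 * C * (1 + norm \<nu>)\<^sup>2"
    proof -
      have "exp (4 * Y) = exp Y ^ 4" using exp_of_nat_mult[of 4 Y] by simp
      moreover have "(2 * (1 + norm \<nu>))\<^sup>2 = 4 * (1 + norm \<nu>)\<^sup>2" by (simp only: power_mult_distrib) simp
      ultimately show ?thesis by (simp add: power_divide del: distrib_left_numeral)
    qed
    finally have 1: "norm (of_real pi ^ 4 * (2 * \<nu> + 1)\<^sup>2 * legendre_moment 4 \<nu> / (2 * sin (of_real pi * \<nu>) ^ 4))
        \<le> 512 * pi ^ 4 * C * (1 + norm \<nu>)\<^sup>2" .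
    have nz: "- \<nu> \<noteq> 0" "1 - \<nu> \<noteq> 0" using \<open>1 \<le> norm \<nu>\<close> \<open>1 \<le> norm (1 - \<nu>)\<close> by auto
    have inv: "norm (2 / w ^ 3) \<le> 2" if "1 \<le> norm w" for w :: complex
      using that one_le_power[of "norm w" 3] by (simp add: norm_divide norm_power divide_le_eq)
    have "norm (Polygamma 2 (- \<nu>)) \<le> 2 * zeta3 + 4"
    proof -
      have "Polygamma 2 (- \<nu>) = Polygamma 2 (2 - \<nu>) - 2 / (1 - \<nu>) ^ 3 - 2 / (- \<nu>) ^ 3"
        using Polygamma_2_plus1[OF nz(1)] Polygamma_2_plus1[OF nz(2)] by (simp add: algebra_simps)
      also have "norm \<dots> \<le> norm (Polygamma 2 (2 - \<nu>)) + norm (2 / (1 - \<nu>) ^ 3) + norm (2 / (- \<nu>) ^ 3)"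
        by (intro norm_triangle_le_diff add_mono order_refl)
      also have "\<dots> \<le> 2 * zeta3 + 2 + 2"
        by (intro add_mono norm_Polygamma_2_le inv) (use \<nu> \<open>1 \<le> norm \<nu>\<close> \<open>1 \<le> norm (1 - \<nu>)\<close> in auto)
      finally show ?thesis by simp
    qed
    moreover have "norm (Polygamma 2 (\<nu> + 1)) \<le> 2 * zeta3" by (rule norm_Polygamma_2_le) (use \<nu> in simp)
    moreover have "norm (Polygamma 2 (\<nu> + 1) + Polygamma 2 (- \<nu>) + 28 * of_real zeta3)
        \<le> norm (Polygamma 2 (\<nu> + 1)) + norm (Polygamma 2 (- \<nu>)) + norm (28 * complex_of_real zeta3)"
      by (intro norm_triangle_le add_mono order_refl)
    moreover have "norm (28 * complex_of_real zeta3) = 28 * zeta3" using z0 by (simp add: norm_mult)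
    ultimately have 2: "norm (Polygamma 2 (\<nu> + 1) + Polygamma 2 (- \<nu>) + 28 * of_real zeta3) \<le> 32 * zeta3 + 4" by linarith
    have "(32 * zeta3 + 4) * 1 \<le> (32 * zeta3 + 4) * (1 + norm \<nu>)\<^sup>2"
      using z0 by (intro mult_left_mono one_le_power) auto
    moreover have "norm (defect \<nu>) \<le> norm (of_real pi ^ 4 * (2 * \<nu> + 1)\<^sup>2 * legendre_moment 4 \<nu> / (2 * sin (of_real pi * \<nu>) ^ 4))
        + norm (Polygamma 2 (\<nu> + 1) + Polygamma 2 (- \<nu>) + 28 * of_real zeta3)"
      unfolding defect_def by (rule norm_triangle_ineq4)
    ultimately show "norm (defect \<nu>) \<le> K * (1 + norm \<nu>)\<^sup>2"
      using 1 2 by (simp add: K_def ring_distribs)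
  qed
qed

section \<open>Vanishing of the defect\<close>

lemma in_ball_0_1_not_Ints: "z \<in> ball 0 1 - {0} \<Longrightarrow> z \<notin> \<int>" for z :: complex
  by (auto elim!: Ints_cases)

text \<open>
  The function \<open>D\<close> below is \<open>sin\<^sup>4 (\<pi> z)\<close> times the defect, with the pole of \<open>\<psi>'' (- z)\<close> at 0 split off, so
  that it is visibly holomorphic. It is even, and \<open>D t / t\<^sup>2\<close> tends to 0 for real \<open>t\<close> by the expansion of
  the fourth moment in terms of the second and the first; so \<open>D\<close> has a zero of order four, which
  matches that of \<open>sin\<^sup>4 (\<pi> z)\<close>.
\<close>

lemma defect_has_limit_at_0: "\<exists>L. (defect \<longlongrightarrow> L) (at 0)"
proof -
  define s where "s = (\<lambda>z::complex. sin (of_real pi * z))"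
  have "s holomorphic_on ball 0 1" unfolding s_def by (intro holomorphic_intros)
  moreover have "s 0 = 0" by (simp add: s_def)
  ultimately obtain g where g: "g holomorphic_on ball 0 1" and sg: "\<And>z. s z = z * g z"
    by (rule holomorphic_factor_zero) blast
  have g0: "g 0 \<noteq> 0"
  proof -
    have "(g has_field_derivative deriv g 0) (at 0)"
      by (rule holomorphic_derivI[OF g]) auto
    then have "((\<lambda>z. z * g z) has_field_derivative 1 * g 0 + deriv g 0 * 0) (at 0)"
      using DERIV_mult[OF DERIV_ident, of g "deriv g 0" 0 UNIV] by simp
    moreover have "s = (\<lambda>z. z * g z)" by (rule ext) (rule sg)
    ultimately have "(s has_field_derivative g 0) (at 0)" by simp
    moreover have "(s has_field_derivative cos (of_real pi * 0) * of_real pi) (at 0)"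
      unfolding s_def by (intro DERIV_chain2[where f = sin] DERIV_sin DERIV_cmult_Id)
    ultimately have "g 0 = cos (of_real pi * 0) * of_real pi" by (rule DERIV_unique)
    then show ?thesis by simp
  qed
  define q where "q = (\<lambda>z. Polygamma 2 (1 + z) + Polygamma 2 (1 - z) + 28 * complex_of_real zeta3)"
  have q: "q holomorphic_on ball 0 1"
  proof -
    have "w \<notin> \<int>\<^sub>\<le>\<^sub>0" if "0 < Re w" for w :: complex
      using that by (auto elim!: nonpos_Ints_cases)
    moreover have "0 < Re (1 + z)" "0 < Re (1 - z)" if "z \<in> ball 0 1" for z :: complex
      using that abs_Re_le_cmod[of z] by auto
    ultimately have "1 + z \<notin> \<int>\<^sub>\<le>\<^sub>0" "1 - z \<notin> \<int>\<^sub>\<le>\<^sub>0" if "z \<in> ball 0 1" for z :: complex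
      using that by blast+
    then show ?thesis
      unfolding q_def by (intro holomorphic_intros holomorphic_on_Polygamma_compose)
  qed
  \<comment> \<open>The last term is \<open>sin\<^sup>4 (\<pi> z) (2 / z\<^sup>3)\<close>, the contribution of the pole of \<open>\<psi>'' (- z)\<close>.\<close>
  define D where "D = (\<lambda>z. of_real pi ^ 4 / 2 * (2 * z + 1)\<^sup>2 * legendre_moment 4 z - s z ^ 4 * q z - 2 * z * g z ^ 4)"
  have D_defect: "D z = s z ^ 4 * defect z" if z: "z \<in> ball 0 1 - {0}" for z
  proof -
    have nz: "z \<noteq> 0" "- z \<noteq> 0" using z by auto
    have "s z \<noteq> 0" using in_ball_0_1_not_Ints[OF z] by (simp add: s_def sin_pi_eq_0_iff)
    have "Polygamma 2 (- z + 1) = Polygamma 2 (- z) + 2 / (- z) ^ 3" by (rule Polygamma_2_plus1[OF nz(2)])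
    then have "Polygamma 2 (- z) = Polygamma 2 (1 - z) + 2 / z ^ 3" by (simp add: power3_eq_cube)
    then have "Polygamma 2 (z + 1) + Polygamma 2 (- z) + 28 * of_real zeta3 = q z + 2 / z ^ 3"
      by (simp add: q_def add_ac)
    then have "defect z = of_real pi ^ 4 * (2 * z + 1)\<^sup>2 * legendre_moment 4 z / (2 * s z ^ 4) - (q z + 2 / z ^ 3)"
      by (simp only: defect_def s_def)
    then have "s z ^ 4 * defect z = s z ^ 4 * (of_real pi ^ 4 * (2 * z + 1)\<^sup>2 * legendre_moment 4 z / (2 * s z ^ 4)) - s z ^ 4 * q z - s z ^ 4 * (2 / z ^ 3)"
      by (simp only: right_diff_distrib distrib_left diff_diff_eq)
    also have "s z ^ 4 * (of_real pi ^ 4 * (2 * z + 1)\<^sup>2 * legendre_moment 4 z / (2 * s z ^ 4)) = of_real pi ^ 4 / 2 * (2 * z + 1)\<^sup>2 * legendre_moment 4 z"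
      using \<open>s z \<noteq> 0\<close> by simp
    also have "s z ^ 4 * (2 / z ^ 3) = 2 * z * g z ^ 4"
      using nz unfolding sg by (simp add: power_mult_distrib eval_nat_numeral)
    finally show ?thesis by (simp add: D_def)
  qed
  have Dhol: "D holomorphic_on ball 0 1"
  proof -
    have "legendre_moment 4 holomorphic_on ball 0 1"
      using holomorphic_legendre_moment[of 4] by (rule holomorphic_on_subset) auto
    then show ?thesis unfolding D_def s_def by (intro holomorphic_intros g q) auto
  qed
  have Deven: "D (- z) = D z" if z: "z \<in> ball 0 1 - {0}" for z
  proof -
    have "- z \<in> ball 0 1 - {0}" using z by auto
    then have "D (- z) = s (- z) ^ 4 * defect (- z)" by (rule D_defect)
    also have "s (- z) ^ 4 = s z ^ 4" by (simp add: s_def)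
    also have "defect (- z) = defect z" by (rule defect_even[OF in_ball_0_1_not_Ints[OF z]])
    finally show ?thesis using D_defect[OF z] by simp
  qed
  \<comment> \<open>For real \<open>t\<close> the quotient \<open>D t / t\<^sup>2\<close> splits into three parts that tend to 0: the explicit part \<open>h\<close>,
    the remainder \<open>r\<close> of the fourth moment, and the regular part \<open>k\<close> of the polygamma terms.\<close>
  define k where "k = (\<lambda>z. z\<^sup>2 * g z ^ 4 * q z)"
  define h where "h = (\<lambda>t::real. pi ^ 4 / 2 * (2 * t + 1)\<^sup>2 / t\<^sup>2 *
       (12 * (sin (pi * t))\<^sup>2 / (pi\<^sup>2 * t * (t + 1)) - 16 * sin (pi * t) / (pi * (1 - t) * (2 + t)))
     - 2 * sin (pi * t) ^ 4 / t ^ 5)"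
  define r where "r = (\<lambda>t::real. legendre_moment 4 (of_real t) - 6 * legendre_moment 2 (of_real t) + 8 * legendre_moment 1 (of_real t))"
  have ev: "eventually (\<lambda>t::real. 0 < t \<and> t < 1) (at_right 0)"
    by (rule eventually_mono[OF eventually_at_right_real[of 0 1]]) auto
  have split: "of_real (h t) + of_real (pi ^ 4 / 2 * (2 * t + 1)\<^sup>2 / t\<^sup>2) * r t - k (of_real t) = D (of_real t) / (of_real t)\<^sup>2"
    if t: "0 < t" "t < 1" for t
  proof -
    define z where "z = complex_of_real t"
    have st: "s z = of_real (sin (pi * t))" by (simp add: s_def z_def flip: sin_of_real)
    have nz: "z \<noteq> 0" "z + 1 \<noteq> 0" "1 - z \<noteq> 0" "2 + z \<noteq> 0" "z \<noteq> -1"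
      using t by (auto simp: z_def complex_eq_iff)
    have s1: "sin (of_real pi * (z + 1)) = - s z" by (simp add: s_def sin_pi_plus_1)
    have "z * (z + 1) * legendre_moment 2 z = 2 * (s z / of_real pi)\<^sup>2"
      using legendre_moment_2[OF nz(5)] by (simp add: s1)
    moreover have "z * (z + 1) \<noteq> 0" using nz by simp
    ultimately have "legendre_moment 2 z = 2 * (s z / of_real pi)\<^sup>2 / (z * (z + 1))"
      by (metis nonzero_mult_div_cancel_left)
    then have M2: "legendre_moment 2 z = 2 * (s z)\<^sup>2 / ((of_real pi)\<^sup>2 * z * (z + 1))"
      by (simp add: power_divide mult_ac)
    have "(1 - z) * (2 + z) * legendre_moment 1 z = 2 * s z / of_real pi"
      using legendre_moment_1[OF nz(5)] by (simp add: s1)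
    moreover have "(1 - z) * (2 + z) \<noteq> 0" using nz by simp
    ultimately have "legendre_moment 1 z = 2 * s z / of_real pi / ((1 - z) * (2 + z))"
      by (metis nonzero_mult_div_cancel_left)
    then have M1: "legendre_moment 1 z = 2 * s z / (of_real pi * (1 - z) * (2 + z))"
      by (simp add: mult_ac)
    have gz: "g z = s z / z" using nz by (simp add: sg)
    have hz: "of_real (h t) = of_real pi ^ 4 / 2 * (2 * z + 1)\<^sup>2 / z\<^sup>2 * (6 * legendre_moment 2 z - 8 * legendre_moment 1 z) - 2 * s z ^ 4 / z ^ 5"
      unfolding h_def M1 M2 unfolding st unfolding z_def by simp
    have pz: "of_real (pi ^ 4 / 2 * (2 * t + 1)\<^sup>2 / t\<^sup>2) = of_real pi ^ 4 / 2 * (2 * z + 1)\<^sup>2 / z\<^sup>2"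
      by (simp add: z_def)
    have "A / z\<^sup>2 * (6 * b - 8 * c) - 2 * S ^ 4 / z ^ 5 + A / z\<^sup>2 * (a - 6 * b + 8 * c) - z\<^sup>2 * (S / z) ^ 4 * Q
        = (A * a - S ^ 4 * Q - 2 * z * (S / z) ^ 4) / z\<^sup>2" for A a b c S Q
      using nz(1) by (simp add: field_simps eval_nat_numeral)
    then show ?thesis
      unfolding hz pz r_def k_def D_def z_def[symmetric] gz by blast
  qed
  have hlim: "((\<lambda>t. complex_of_real (h t)) \<longlongrightarrow> of_real 0) (at_right 0)"
    unfolding h_def by (intro tendsto_of_real real_defect_limit)
  have klim: "((\<lambda>t. k (of_real t)) \<longlongrightarrow> k 0) (at_right 0)"
    by (rule filterlim_compose[OF holomorphic_tendsto_0 filterlim_of_real_at_right_0])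
       (unfold k_def, intro holomorphic_intros g q)
  have rlim: "((\<lambda>t. of_real (pi ^ 4 / 2 * (2 * t + 1)\<^sup>2 / t\<^sup>2) * r t) \<longlongrightarrow> 0) (at_right 0)"
  proof -
    obtain C where C: "\<And>t. norm (r t) \<le> C * \<bar>t\<bar> ^ 3"
      unfolding r_def by (rule legendre_moment_4_near_0) blast
    show ?thesis
    proof (rule Lim_null_comparison)
      show "\<forall>\<^sub>F t in at_right 0. norm (of_real (pi ^ 4 / 2 * (2 * t + 1)\<^sup>2 / t\<^sup>2) * r t) \<le> pi ^ 4 / 2 * (2 * t + 1)\<^sup>2 * C * t"
        using ev
      proof eventually_elim
        case (elim t)
        have "norm (of_real (pi ^ 4 / 2 * (2 * t + 1)\<^sup>2 / t\<^sup>2) * r t) \<le> (pi ^ 4 / 2 * (2 * t + 1)\<^sup>2 / t\<^sup>2) * (C * \<bar>t\<bar> ^ 3)"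
          unfolding norm_mult norm_of_real by (intro mult_mono C) auto
        also have "\<dots> = pi ^ 4 / 2 * (2 * t + 1)\<^sup>2 * C * t"
          using elim by (simp add: eval_nat_numeral)
        finally show ?case .
      qed
      have "((\<lambda>t. pi ^ 4 / 2 * (2 * t + 1)\<^sup>2 * C * t) \<longlongrightarrow> pi ^ 4 / 2 * (2 * 0 + 1)\<^sup>2 * C * 0) (at_right 0)"
        by (intro tendsto_intros)
      then show "((\<lambda>t. pi ^ 4 / 2 * (2 * t + 1)\<^sup>2 * C * t) \<longlongrightarrow> 0) (at_right 0)" by simp
    qed
  qed
  have "((\<lambda>t. of_real (h t) + of_real (pi ^ 4 / 2 * (2 * t + 1)\<^sup>2 / t\<^sup>2) * r t - k (of_real t)) \<longlongrightarrow> of_real 0 + 0 - k 0) (at_right 0)"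
    by (intro tendsto_intros hlim klim rlim)
  then have "((\<lambda>t. D (of_real t) / (of_real t)\<^sup>2) \<longlongrightarrow> of_real 0 + 0 - k 0) (at_right 0)"
    by (rule Lim_transform_eventually) (use ev in eventually_elim, use split in blast)
  then have Dlim: "((\<lambda>t. D (of_real t) / (of_real t)\<^sup>2) \<longlongrightarrow> 0) (at_right 0)" by (simp add: k_def)
  obtain d where d: "d holomorphic_on ball 0 1" "\<And>z. D z = z ^ 4 * d z"
    using even_holomorphic_factor_fourth_power[OF Dhol Deven Dlim] by blast
  have "((\<lambda>z. d z / g z ^ 4) \<longlongrightarrow> d 0 / g 0 ^ 4) (at 0)"
    using g0 by (intro tendsto_intros holomorphic_tendsto_0 d g) auto
  then have "(defect \<longlongrightarrow> d 0 / g 0 ^ 4) (at 0)"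
  proof (rule Lim_transform_eventually)
    have "eventually (\<lambda>z. z \<in> ball 0 1 - {0}) (at (0::complex))"
      by (rule eventually_at_in_open) auto
    then show "\<forall>\<^sub>F z in at 0. d z / g z ^ 4 = defect z"
    proof eventually_elim
      case (elim z)
      have "z \<noteq> 0" using elim by auto
      have "s z \<noteq> 0" using in_ball_0_1_not_Ints[OF elim] by (simp add: s_def sin_pi_eq_0_iff)
      then have "g z \<noteq> 0" by (simp add: sg)
      have "z ^ 4 * d z = z ^ 4 * (g z ^ 4 * defect z)"
        using D_defect[OF elim] by (simp add: d(2) sg power_mult_distrib mult_ac)
      then have "d z = g z ^ 4 * defect z" using \<open>z \<noteq> 0\<close> by simp
      then show ?case using \<open>g z \<noteq> 0\<close> by simp
    qed
  qed
  then show ?thesis ..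
qed

lemma periodic_of_int:
  fixes f :: "complex \<Rightarrow> complex"
  assumes "\<And>z. f (z + 1) = f z"
  shows "f (z + of_int n) = f z"
proof (induction n rule: int_induct[where k = 0])
  case (step1 i)
  then show ?case using assms[of "z + of_int i"] by (simp add: add.assoc)
next
  case (step2 i)
  then show ?case using assms[of "z + of_int (i - 1)"] by (simp add: algebra_simps)
qed simp

text \<open>
  By periodicity the bound holds everywhere with another constant, so that \<open>f\<close> is a polynomial by
  Liouville's theorem; and a periodic polynomial is constant.
\<close>

lemma periodic_quadratic_growth_imp_constant:
  fixes f :: "complex \<Rightarrow> complex"
  assumes hol: "f holomorphic_on UNIV" and per: "\<And>z. f (z + 1) = f z"
    and K: "0 \<le> K" "\<And>z. 0 \<le> Re z \<Longrightarrow> Re z \<le> 1 \<Longrightarrow> 1 \<le> \<bar>Im z\<bar> \<Longrightarrow> norm (f z) \<le> K * (1 + norm z)\<^sup>2"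
  shows "f z = f 0"
proof -
  define R where "R = cbox (Complex 0 (-1)) (Complex 1 1)"
  have "compact (f ` R)"
    unfolding R_def
    by (intro compact_continuous_image holomorphic_on_imp_continuous_on holomorphic_on_subset[OF hol]) auto
  then obtain B where B: "\<And>z. z \<in> R \<Longrightarrow> norm (f z) \<le> B"
    by (meson bounded_iff compact_imp_bounded imageI)
  have strip: "norm (f z) \<le> max K B * (1 + norm z)\<^sup>2" if z: "0 \<le> Re z" "Re z \<le> 1" for z
  proof (cases "1 \<le> \<bar>Im z\<bar>")
    case True
    then have "norm (f z) \<le> K * (1 + norm z)\<^sup>2" using K(2) z by blast
    also have "\<dots> \<le> max K B * (1 + norm z)\<^sup>2" by (intro mult_right_mono) auto
    finally show ?thesis .
  next
    case False
    then have "norm (f z) \<le> B" using z by (intro B) (auto simp: R_def in_cbox_complex_iff)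
    also have "\<dots> \<le> max K B * 1" by simp
    also have "\<dots> \<le> max K B * (1 + norm z)\<^sup>2"
      using K(1) by (intro mult_left_mono one_le_power) auto
    finally show ?thesis .
  qed
  have growth: "norm (f z) \<le> (9 * max K B) * norm z ^ 2" if "1 \<le> norm z" for z
  proof -
    define w where "w = z + of_int (- \<lfloor>Re z\<rfloor>)"
    have w: "0 \<le> Re w" "Re w \<le> 1" "Im w = Im z" by (simp_all add: w_def) linarith+
    have "norm w \<le> \<bar>Re w\<bar> + \<bar>Im w\<bar>" by (rule cmod_le)
    also have "\<dots> \<le> 1 + norm z" using w abs_Im_le_cmod[of z] by simp
    finally have "1 + norm w \<le> 3 * norm z" using that by simp
    then have "(1 + norm w)\<^sup>2 \<le> (3 * norm z)\<^sup>2" by (intro power_mono) auto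
    then have "max K B * (1 + norm w)\<^sup>2 \<le> max K B * (3 * norm z)\<^sup>2" using K(1) by (intro mult_left_mono) auto
    moreover have "f z = f w" unfolding w_def by (rule periodic_of_int[of f, OF per, symmetric])
    ultimately show ?thesis using strip[OF w(1,2)] by (simp add: power_mult_distrib mult_ac)
  qed
  define c where "c = (\<lambda>k. (deriv ^^ k) f 0 / fact k)"
  have poly: "f w = (\<Sum>k\<le>2. c k * w ^ k)" for w
    unfolding c_def by (rule Liouville_polynomial[OF hol growth])
  then have poly': "f w = c 0 + c 1 * w + c 2 * w\<^sup>2" for w by (simp add: eval_nat_numeral)
  have "f 1 = f 0" using per[of 0] by simp
  moreover have "f (- 1) = f 0" using per[of "- 1"] by simp
  ultimately have "c 1 + c 2 = 0" "c 2 - c 1 = 0" by (simp_all add: poly')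
  then have "c 1 = 0 \<and> c 2 = 0" by algebra
  then show ?thesis by (simp add: poly')
qed

theorem defect_eq_0:
  assumes "\<nu> \<notin> \<int>"
  shows "defect \<nu> = 0"
proof -
  obtain L where L: "(defect \<longlongrightarrow> L) (at 0)" using defect_has_limit_at_0 by blast
  \<comment> \<open>By periodicity one and the same value removes the singularities at all integers.\<close>
  define f where "f = (\<lambda>z. if z \<in> \<int> then L else defect z)"
  have per: "f (z + 1) = f z" for z
  proof (cases "z \<in> \<int>")
    case False
    then have "z + 1 \<notin> \<int>" using Ints_diff[of "z + 1" 1] by auto
    with False show ?thesis by (simp add: f_def defect_plus_1)
  qed (simp add: f_def)
  have f0: "f holomorphic_on ball 0 1"
  proof (rule no_isolated_singularity'[where K = "{0}"])
    have "eventually (\<lambda>z. z \<in> ball 0 1 - {0}) (at (0::complex))"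
      by (rule eventually_at_in_open) auto
    then have "eventually (\<lambda>z. defect z = f z) (at 0)"
      by eventually_elim (simp add: f_def in_ball_0_1_not_Ints)
    with L have "(f \<longlongrightarrow> L) (at 0)" by (rule Lim_transform_eventually)
    then show "(f \<longlongrightarrow> f z) (at z within ball 0 1)" if "z \<in> {0}" for z
      using that by (auto simp: f_def intro: tendsto_within_subset)
    have "defect holomorphic_on ball 0 1 - {0}"
      using holomorphic_defect by (rule holomorphic_on_subset) (use in_ball_0_1_not_Ints in auto)
    then show "f holomorphic_on ball 0 1 - {0}"
      by (rule holomorphic_transform) (simp add: f_def in_ball_0_1_not_Ints)
  qed auto
  have hol: "f holomorphic_on UNIV"
  proof -
    have "f field_differentiable (at z)" for z
    proof (cases "z \<in> \<int>")
      case True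
      then obtain n where n: "z = of_int n" by (auto elim: Ints_cases)
      have "(f has_field_derivative deriv f 0) (at 0)" by (rule holomorphic_derivI[OF f0]) auto
      then have "((\<lambda>w. f (w + of_int (- n))) has_field_derivative deriv f 0) (at (0 - of_int (- n)))"
        using DERIV_shift[of f "deriv f 0" "0 - of_int (- n)" "of_int (- n)"] by simp
      then show ?thesis
        unfolding field_differentiable_def periodic_of_int[of f, OF per] n by auto
    next
      case False
      have "f holomorphic_on - \<int>"
        using holomorphic_defect by (rule holomorphic_transform) (simp add: f_def)
      then show ?thesis
        using False by (intro holomorphic_on_imp_differentiable_at[of f "- \<int>"]) auto
    qed
    then show ?thesis by (simp add: holomorphic_on_def)
  qed
  obtain K where K: "0 \<le> K" "\<And>\<nu>. 0 \<le> Re \<nu> \<Longrightarrow> Re \<nu> \<le> 1 \<Longrightarrow> 1 \<le> \<bar>Im \<nu>\<bar> \<Longrightarrow> norm (defect \<nu>) \<le> K * (1 + norm \<nu>)\<^sup>2"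
    by (rule defect_bound_strip) blast
  have const: "f z = f 0" for z
  proof (rule periodic_quadratic_growth_imp_constant[OF hol per K(1)])
    fix z assume z: "0 \<le> Re z" "Re z \<le> 1" "1 \<le> \<bar>Im z\<bar>"
    then have "z \<notin> \<int>" by (auto elim!: Ints_cases)
    then show "norm (f z) \<le> K * (1 + norm z)\<^sup>2" using K(2)[OF z] by (simp add: f_def)
  qed
  have half: "- 1 / 2 \<notin> (\<int> :: complex set)"
  proof
    assume "- 1 / 2 \<in> (\<int> :: complex set)"
    then obtain n where "- 1 / 2 = complex_of_int n" by (auto elim: Ints_cases)
    then have "Re (- 1 / 2) = Re (complex_of_int n)" by (simp only:)
    then have "real_of_int (2 * n + 1) = 0" by simp
    then have "2 * n + 1 = 0" by (simp only: of_int_eq_0_iff)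
    then show False by presburger
  qed
  have "defect (- 1 / 2) = 0"
    by (simp add: defect_def Polygamma_2_half)
  then have "f (- 1 / 2) = 0" using half by (simp add: f_def)
  with const have "f \<nu> = 0" by metis
  with assms show ?thesis by (simp add: f_def)
qed

theorem proposition3p2:
  shows "\<exists>F :: complex \<Rightarrow> complex.
           continuous_on UNIV F \<and>
           (\<forall>\<nu>. \<nu> \<notin> exceptional \<longrightarrow> F \<nu> = closed_form \<nu>) \<and>
           (\<forall>\<nu>. set_integrable lborel {-1<..<1} (\<lambda>x::real. of_real x * legendre_P \<nu> x ^ 4) \<and>
                (LINT x:{-1<..<1}|lborel. of_real x * legendre_P \<nu> x ^ 4) = F \<nu>)"
proof (intro exI conjI allI impI)
  show "continuous_on UNIV (legendre_moment 4)"
    by (rule holomorphic_on_imp_continuous_on[OF holomorphic_legendre_moment]) simp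
  show "set_integrable lborel {-1<..<1} (\<lambda>x::real. of_real x * legendre_P \<nu> x ^ 4)" for \<nu>
    by (rule set_integrable_x_legendre_P_power) simp
  show "(LINT x:{-1<..<1}|lborel. of_real x * legendre_P \<nu> x ^ 4) = legendre_moment 4 \<nu>" for \<nu>
    by (simp add: legendre_moment_def)
  fix \<nu> :: complex assume "\<nu> \<notin> exceptional"
  then have \<nu>: "\<nu> \<notin> \<int>" "\<nu> \<noteq> - 1 / 2" by (auto simp: exceptional_def)
  define S where "S = sin (\<nu> * of_real pi)"
  define Q where "Q = Polygamma 2 (\<nu> + 1) + Polygamma 2 (- \<nu>) + 28 * complex_of_real zeta3"
  have "S \<noteq> 0" using \<nu>(1) by (simp add: S_def mult.commute[of \<nu>] sin_pi_eq_0_iff)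
  have "2 * \<nu> + 1 \<noteq> 0"
  proof
    assume "2 * \<nu> + 1 = 0"
    then have "2 * \<nu> = - 1" by (simp add: add_eq_0_iff2)
    then have "\<nu> = - 1 / 2" by (simp add: field_simps)
    with \<nu>(2) show False by simp
  qed
  have "of_real pi ^ 4 * (2 * \<nu> + 1)\<^sup>2 * legendre_moment 4 \<nu> / (2 * S ^ 4) = Q"
    using defect_eq_0[OF \<nu>(1)] by (simp add: defect_def S_def Q_def mult.commute[of \<nu>])
  then have "legendre_moment 4 \<nu> = 2 * S ^ 4 * Q / ((2 * \<nu> + 1)\<^sup>2 * of_real pi ^ 4)"
    using \<open>S \<noteq> 0\<close> \<open>2 * \<nu> + 1 \<noteq> 0\<close> by (auto simp: divide_simps mult_ac)
  then show "legendre_moment 4 \<nu> = closed_form \<nu>"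
    by (simp add: closed_form_def S_def Q_def)
qed

end
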